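(* Let $\mathfrak{A}$ be a $(k,p,q)$-differential subalgebra of the $C^*$-algebra $\mathfrak{B}$. Then $\mathfrak{A}$ is locally regular.
   Context: Let $\mathfrak{B}$ be a $C^*$-algebra with norm $\|\cdot\|_{\mathfrak{B}}$. A $(k,p,q)$-differential subalgebra of $\mathfrak{B}$ is a $*$-subalgebra $\mathfrak{A}\subseteq\mathfrak{B}$ equipped with its own norm $\|\cdot\|_{\mathfrak{A}}$ making it a Banach $*$-algebra on which the involution is continuous, where $k\in\mathbb{Z}$, $k\geq 2$, and $p,q>0$ are reals with $p+q=k$, such that for some constant $C>0$, $\|a^k\|_{\mathfrak{A}}\leq C\|a\|_{\mathfrak{A}}^p\|a\|_{\mathfrak{B}}^q$ for all $a\in\mathfrak{A}$. A semisimple commutative Banach algebra $\mathfrak{D}$ with Gelfand spectrum $\Delta$ is regular if for every closed $X\subseteq\Delta$ and every $\omega\in\Delta\setminus X$ there is $d\in\mathfrak{D}$ whose Gelfand transform $\hat d$ vanishes on $X$ and satisfies $\hat d(\omega)\neq0$. For $b\in\mathfrak{A}$, $\mathfrak{A}(b)$ is the closed subalgebra of $\mathfrak{A}$ generated by $b$. A reduced Banach $*$-algebra $\mathfrak{A}$ is locally regular if there is a subset $R\subseteq\mathfrak{A}_{\rm sa}$ (the self-adjoint elements), dense in $\mathfrak{A}_{\rm sa}$, such that $\mathfrak{A}(b)$ is regular for all $b\in R$. *)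

theory Defs
  imports "HOL-Analysis.Analysis"
begin

class cvector = real_vector +
  fixes cscale :: "complex \<Rightarrow> 'a \<Rightarrow> 'a"
  assumes cscale_add_right: "cscale a (x + y) = cscale a x + cscale a y"
    and cscale_add_left: "cscale (a + b) x = cscale a x + cscale b x"
    and cscale_cscale: "cscale a (cscale b x) = cscale (a * b) x"
    and cscale_one: "cscale 1 x = x"
    and scaleR_cscale: "scaleR r x = cscale (complex_of_real r) x"

class cstar_algebra = cvector + real_normed_algebra + banach +
  fixes invol :: "'a \<Rightarrow> 'a"
  assumes norm_cscale: "norm (cscale a x) = cmod a * norm x"
    and mult_cscale_left: "cscale a x * y = cscale a (x * y)"
    and mult_cscale_right: "x * cscale a y = cscale a (x * y)"
    and invol_invol: "invol (invol x) = x"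
    and invol_add: "invol (x + y) = invol x + invol y"
    and invol_cscale: "invol (cscale a x) = cscale (cnj a) (invol x)"
    and invol_mult: "invol (x * y) = invol y * invol x"
    and cstar_identity: "norm (invol x * x) = (norm x)\<^sup>2"

definition subalgebra :: "'a::cstar_algebra set \<Rightarrow> bool" where
  "subalgebra S \<longleftrightarrow> 0 \<in> S \<and> (\<forall>x\<in>S. \<forall>y\<in>S. x + y \<in> S \<and> x * y \<in> S)
     \<and> (\<forall>c. \<forall>x\<in>S. cscale c x \<in> S)"

definition star_subalgebra :: "'a::cstar_algebra set \<Rightarrow> bool" where
  "star_subalgebra S \<longleftrightarrow> subalgebra S \<and> (\<forall>x\<in>S. invol x \<in> S)"

definition algebra_norm_on :: "'a::cstar_algebra set \<Rightarrow> ('a \<Rightarrow> real) \<Rightarrow> bool" where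
  "algebra_norm_on S n \<longleftrightarrow>
     (\<forall>x\<in>S. 0 \<le> n x \<and> (n x = 0 \<longleftrightarrow> x = 0))
     \<and> (\<forall>x\<in>S. \<forall>y\<in>S. n (x + y) \<le> n x + n y \<and> n (x * y) \<le> n x * n y)
     \<and> (\<forall>c. \<forall>x\<in>S. n (cscale c x) = cmod c * n x)"

definition banach_star_subalgebra :: "'a::cstar_algebra set \<Rightarrow> ('a \<Rightarrow> real) \<Rightarrow> bool" where
  "banach_star_subalgebra S n \<longleftrightarrow> star_subalgebra S \<and> algebra_norm_on S n
     \<and> (\<forall>X. (\<forall>i. X i \<in> S) \<and> (\<forall>e>0. \<exists>N. \<forall>i\<ge>N. \<forall>j\<ge>N. n (X i - X j) < e)
            \<longrightarrow> (\<exists>y\<in>S. (\<lambda>i. n (X i - y)) \<longlonglongrightarrow> 0))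
     \<and> (\<exists>M. \<forall>x\<in>S. n (invol x) \<le> M * n x)"

text \<open>Positive powers in a possibly non-unital algebra: pow1 x m = x^(m+1).\<close>
primrec pow1 :: "'a::times \<Rightarrow> nat \<Rightarrow> 'a" where
  "pow1 x 0 = x"
| "pow1 x (Suc m) = x * pow1 x m"

definition differential_subalgebra ::
  "nat \<Rightarrow> real \<Rightarrow> real \<Rightarrow> 'a::cstar_algebra set \<Rightarrow> ('a \<Rightarrow> real) \<Rightarrow> bool" where
  "differential_subalgebra k p q A nA \<longleftrightarrow> banach_star_subalgebra A nA
     \<and> k \<ge> 2 \<and> p > 0 \<and> q > 0 \<and> p + q = real k
     \<and> (\<exists>C>0. \<forall>a\<in>A. nA (pow1 a (k - 1)) \<le> C * nA a powr p * norm a powr q)"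

definition closed_in_norm :: "'a::cstar_algebra set \<Rightarrow> ('a \<Rightarrow> real) \<Rightarrow> 'a set \<Rightarrow> bool" where
  "closed_in_norm A n S \<longleftrightarrow>
     (\<forall>X y. (\<forall>i. X i \<in> S) \<and> y \<in> A \<and> (\<lambda>i. n (X i - y)) \<longlonglongrightarrow> 0 \<longrightarrow> y \<in> S)"

definition gen_closed_subalg :: "'a::cstar_algebra set \<Rightarrow> ('a \<Rightarrow> real) \<Rightarrow> 'a \<Rightarrow> 'a set" where
  "gen_closed_subalg A n b =
     \<Inter>{S. S \<subseteq> A \<and> b \<in> S \<and> subalgebra S \<and> closed_in_norm A n S}"

text \<open>Gelfand spectrum of D: nonzero complex homomorphisms D \<rightarrow> \<complex>,
  represented as functions vanishing outside D.\<close>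
definition characters :: "'a::cstar_algebra set \<Rightarrow> ('a \<Rightarrow> complex) set" where
  "characters D = {\<phi>. (\<forall>x. x \<notin> D \<longrightarrow> \<phi> x = 0)
     \<and> (\<forall>x\<in>D. \<forall>y\<in>D. \<phi> (x + y) = \<phi> x + \<phi> y \<and> \<phi> (x * y) = \<phi> x * \<phi> y)
     \<and> (\<forall>c. \<forall>x\<in>D. \<phi> (cscale c x) = c * \<phi> x)
     \<and> (\<exists>x\<in>D. \<phi> x \<noteq> 0)}"

text \<open>D is a semisimple commutative algebra which is regular; the Gelfand
  (weak-*) topology on the spectrum is the subspace topology of the product
  topology on functions.\<close>
definition regular_alg :: "'a::cstar_algebra set \<Rightarrow> bool" where
  "regular_alg D \<longleftrightarrow>
     (\<forall>x\<in>D. \<forall>y\<in>D. x * y = y * x)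
     \<and> (\<forall>d\<in>D. (\<forall>\<phi>\<in>characters D. \<phi> d = 0) \<longrightarrow> d = 0)
     \<and> (\<forall>X \<omega>. closedin (top_of_set (characters D)) X \<and> \<omega> \<in> characters D - X
          \<longrightarrow> (\<exists>d\<in>D. (\<forall>\<phi>\<in>X. \<phi> d = 0) \<and> \<omega> d \<noteq> 0))"

text \<open>Reduced: A admits a C*-norm (equivalently its *-radical is zero).\<close>
definition reduced :: "'a::cstar_algebra set \<Rightarrow> bool" where
  "reduced A \<longleftrightarrow> (\<exists>\<nu>. algebra_norm_on A \<nu> \<and> (\<forall>a\<in>A. \<nu> (invol a * a) = (\<nu> a)\<^sup>2))"

definition locally_regular :: "'a::cstar_algebra set \<Rightarrow> ('a \<Rightarrow> real) \<Rightarrow> bool" where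
  "locally_regular A n \<longleftrightarrow> reduced A \<and>
     (\<exists>R. R \<subseteq> {a\<in>A. invol a = a}
        \<and> (\<forall>a\<in>A. invol a = a \<longrightarrow> (\<forall>e>0. \<exists>r\<in>R. n (a - r) < e))
        \<and> (\<forall>b\<in>R. regular_alg (gen_closed_subalg A n b)))"

end

theory Submission
  imports Defs "HOL-Computational_Algebra.Fundamental_Theorem_Algebra" "HOL-Real_Asymp.Real_Asymp"
begin

text \<open>Every self-adjoint \<open>b \<in> A\<close> generates a regular algebra. Let \<open>U = 1 + u\<close> be the Cayley transform
  of a small multiple of \<open>b\<close>, a unitary of the unitization. Since \<open>U\<^sup>m - 1\<close> has \<open>C\<^sup>*\<close>-norm at most 2,
  the differential inequality forces \<open>ln (1 + \<parallel>U\<^sup>N - 1\<parallel>\<^sub>A)\<close> to grow at most like \<open>\<bar>N\<bar>\<^sup>\<gamma>\<close> for some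
  \<open>\<gamma> < 1\<close>. This is the non-quasianalytic case: there are bump functions on the circle with arbitrarily
  small support whose Fourier series may be evaluated at \<open>U\<close>, and these separate points from closed
  sets in the spectrum. Semisimplicity holds because self-adjoint elements of the \<open>C\<^sup>*\<close>-algebra attain
  their norm on characters, which also shows that \<open>\<parallel>\<cdot>\<parallel>\<^sub>A\<close> dominates a multiple of the
  \<open>C\<^sup>*\<close>-norm.\<close>

section \<open>Unitization\<close>

text \<open>Why some \<gamma> < 1 works: in the expansion of (U^m - 1)^k the top term is U^(km) - 1
  and the others are U^(jm) - 1 with j < k, while the left side is at most a constant times the p-th
  power of the norm of U^m - 1. So passing from m to km either multiplies the logarithm by at most
  max(p, 1), which is below k because q > 0, or adds only a constant to its value at some jm with j
  < k. Both are slower than linear growth. Why that suffices: coefficients of size exp(-\<kappa>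
  N^g) with \<gamma> < g < 1 beat this growth, and for g < 1 they still allow a nonzero function to
  vanish on an arc; at g = 1 the function would be analytic. The missing unit shapes the rest. Only
  F(U) - F(1) lies in the algebra, so the bump F must also vanish at the point 1 of the circle. This
  is possible because a character with value 1 at U would vanish at b, hence everywhere.\<close>

lemma cscale_zero_left [simp]: "cscale 0 (x::'a::cvector) = 0"
  by (metis add_cancel_right_right cscale_add_left)

lemma cscale_zero_right [simp]: "cscale c (0::'a::cvector) = 0"
  by (metis add_cancel_right_right cscale_add_right)

lemma cscale_minus_left [simp]: "cscale (- c) (x::'a::cvector) = - cscale c x"
  by (metis add_eq_0_iff cscale_add_left cscale_zero_left right_minus)

lemma cscale_minus_right [simp]: "cscale c (- x::'a::cvector) = - cscale c x"
  by (metis add_eq_0_iff cscale_add_right cscale_zero_right right_minus)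

lemma cscale_diff_right: "cscale c (x - y::'a::cvector) = cscale c x - cscale c y"
  using cscale_add_right[of c x "- y"] by simp

lemma cscale_diff_left: "cscale (c - d) (x::'a::cvector) = cscale c x - cscale d x"
  using cscale_add_left[of c "- d" x] by simp

lemma cscale_sum_left: "cscale (sum f I) (x::'a::cvector) = (\<Sum>i\<in>I. cscale (f i) x)"
  by (induction I rule: infinite_finite_induct) (auto simp: cscale_add_left)

class complex_banach_algebra_1 = cvector + real_normed_algebra_1 + banach +
  assumes norm_cscale_1: "norm (cscale a x) = cmod a * norm x"
    and cscale_mult_left_1: "cscale a x * y = cscale a (x * y)"
    and cscale_mult_right_1: "x * cscale a y = cscale a (x * y)"

text \<open>The sum norm below need not be a C*-norm, but it is complete and submultiplicative, has
  \<open>norm 1 = 1\<close>, and restricts to the given norm on elements with scalar part 0. The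
  spectral arguments need no more.\<close>

datatype 'a unitization = Unitization (element: 'a) (scalar: complex)

instantiation unitization :: (cstar_algebra) "{cvector, real_normed_algebra_1}"
begin

definition "0 = Unitization 0 0"
definition "1 = Unitization 0 1"
definition "x + y = Unitization (element x + element y) (scalar x + scalar y)"
definition "x - y = Unitization (element x - element y) (scalar x - scalar y)"
definition "- x = Unitization (- element x) (- scalar x)"
definition "x * y = Unitization (element x * element y + cscale (scalar x) (element y)
  + cscale (scalar y) (element x)) (scalar x * scalar y)"
definition "cscale c x = Unitization (cscale c (element x)) (c * scalar x)"
definition "scaleR r (x::'a unitization) = cscale (complex_of_real r) x"
definition "norm x = norm (element x) + cmod (scalar x)"
definition "dist x y = norm (x - y :: 'a unitization)"
definition "sgn x = scaleR (inverse (norm x)) (x :: 'a unitization)"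
definition "(uniformity :: ('a unitization \<times> 'a unitization) filter)
  = (INF e\<in>{0 <..}. principal {(x, y). dist x y < e})"
definition "open (U :: 'a unitization set)
  = (\<forall>x\<in>U. eventually (\<lambda>(x', y). x' = x \<longrightarrow> y \<in> U) uniformity)"

lemmas unitization_defs = zero_unitization_def one_unitization_def plus_unitization_def
  minus_unitization_def uminus_unitization_def times_unitization_def cscale_unitization_def
  scaleR_unitization_def norm_unitization_def

instance proof
  fix x y z :: "'a unitization" and a b :: complex and r s :: real
  show "x + y + z = x + (y + z)" "x + y = y + x" "0 + x = x" "- x + x = 0" "x - y = x + - y"
    by (simp_all add: unitization_defs add_ac unitization.expand)
  show "x * y * z = x * (y * z)"
    by (simp add: unitization_defs distrib_left distrib_right mult.assoc
        mult_cscale_left mult_cscale_right cscale_add_right cscale_cscale mult_ac add_ac)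
  show "(x + y) * z = x * z + y * z" "x * (y + z) = x * y + x * z"
    by (simp_all add: unitization_defs distrib_left distrib_right
        cscale_add_right cscale_add_left add_ac)
  show "1 * x = x" "x * 1 = x" "(0::'a unitization) \<noteq> 1"
    by (simp_all add: unitization_defs cscale_one)
  show "cscale a (x + y) = cscale a x + cscale a y" "cscale (a + b) x = cscale a x + cscale b x"
    "cscale a (cscale b x) = cscale (a * b) x" "cscale 1 x = x"
    "r *\<^sub>R x = cscale (complex_of_real r) x"
    by (simp_all add: unitization_defs cscale_add_right cscale_add_left cscale_cscale cscale_one
        distrib_left distrib_right)
  show "r *\<^sub>R (x + y) = r *\<^sub>R x + r *\<^sub>R y" "(r + s) *\<^sub>R x = r *\<^sub>R x + s *\<^sub>R x"
    "r *\<^sub>R s *\<^sub>R x = (r * s) *\<^sub>R x" "1 *\<^sub>R x = x"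
    "r *\<^sub>R x * y = r *\<^sub>R (x * y)" "x * r *\<^sub>R y = r *\<^sub>R (x * y)"
    by (simp_all add: unitization_defs cscale_add_right cscale_add_left cscale_cscale cscale_one
        distrib_left distrib_right mult_cscale_left mult_cscale_right mult_ac)
  show "dist x y = norm (x - y)" "sgn x = inverse (norm x) *\<^sub>R x"
    "uniformity = (INF e\<in>{0 <..}. principal {(x, y :: 'a unitization). dist x y < e})"
    "\<And>U. open U = (\<forall>x\<in>U. \<forall>\<^sub>F (x', y :: 'a unitization) in uniformity. x' = x \<longrightarrow> y \<in> U)"
    by (simp_all add: dist_unitization_def sgn_unitization_def uniformity_unitization_def
        open_unitization_def)
  show "norm x = 0 \<longleftrightarrow> x = 0"
    by (cases x) (simp add: unitization_defs add_nonneg_eq_0_iff)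
  show "norm (x + y) \<le> norm x + norm y"
    using norm_triangle_ineq[of "element x" "element y"] norm_triangle_ineq[of "scalar x" "scalar y"]
    by (simp add: unitization_defs)
  show "norm (r *\<^sub>R x) = \<bar>r\<bar> * norm x"
    by (simp add: unitization_defs norm_cscale norm_mult distrib_left)
  show "norm (x * y) \<le> norm x * norm y"
  proof -
    have "norm (element x * element y + cscale (scalar x) (element y) + cscale (scalar y) (element x))
      \<le> norm (element x) * norm (element y) + cmod (scalar x) * norm (element y)
        + cmod (scalar y) * norm (element x)"
      by (intro norm_triangle_le add_mono norm_mult_ineq) (simp_all add: norm_cscale)
    then show ?thesis
      by (simp add: unitization_defs norm_mult algebra_simps)
  qed
  show "norm (1 :: 'a unitization) = 1"
    by (simp add: unitization_defs)
qed

end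

instance unitization :: (cstar_algebra) complex_banach_algebra_1
proof
  fix x y :: "'a unitization" and a :: complex
  show "cscale a x * y = cscale a (x * y)" "x * cscale a y = cscale a (x * y)"
    by (simp_all add: unitization_defs cscale_add_right cscale_add_left cscale_cscale cscale_one
        distrib_left distrib_right mult_cscale_left mult_cscale_right mult_ac)
  show "norm (cscale a x) = cmod a * norm x"
    by (simp add: unitization_defs norm_cscale norm_mult distrib_left)
next
  fix X :: "nat \<Rightarrow> 'a unitization"
  assume X: "Cauchy X"
  have le: "norm (element x) \<le> norm x" "cmod (scalar x) \<le> norm x" for x :: "'a unitization"
    by (simp_all add: norm_unitization_def)
  have sub: "element (x - y) = element x - element y" "scalar (x - y) = scalar x - scalar y"
    for x y :: "'a unitization"
    by (simp_all add: minus_unitization_def)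
  have "Cauchy (\<lambda>i. element (X i))"
    using X unfolding Cauchy_def dist_norm dist_unitization_def
    by (metis le(1) order_le_less_trans sub(1))
  moreover have "Cauchy (\<lambda>i. scalar (X i))"
    using X unfolding Cauchy_def dist_norm dist_unitization_def
    by (metis le(2) order_le_less_trans sub(2))
  ultimately obtain a c where ac: "(\<lambda>i. element (X i)) \<longlonglongrightarrow> a" "(\<lambda>i. scalar (X i)) \<longlonglongrightarrow> c"
    by (meson Cauchy_convergent convergent_def)
  have "(\<lambda>i. norm (element (X i) - a) + cmod (scalar (X i) - c)) \<longlonglongrightarrow> 0 + 0"
    using ac by (intro tendsto_add) (auto simp: tendsto_norm_zero_iff LIM_zero_iff)
  then have "(\<lambda>i. dist (X i) (Unitization a c)) \<longlonglongrightarrow> 0"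
    by (simp add: dist_unitization_def norm_unitization_def minus_unitization_def)
  then have "X \<longlonglongrightarrow> Unitization a c"
    by (subst tendsto_dist_iff)
  then show "convergent X"
    by (auto simp: convergent_def)
qed

section \<open>Spectral radius\<close>

definition is_invertible :: "'a::ring_1 \<Rightarrow> bool" where
  "is_invertible x \<longleftrightarrow> (\<exists>y. x * y = 1 \<and> y * x = 1)"

lemma is_invertible_mult: "is_invertible x \<Longrightarrow> is_invertible y \<Longrightarrow> is_invertible (x * y)"
  unfolding is_invertible_def by (metis mult.assoc mult_1_left)

text \<open>A right inverse of \<open>x\<close> is \<open>y * z\<close>, with \<open>z\<close> the
  inverse of the product. It is also a left inverse because \<open>z\<close> commutes with
  \<open>y\<close>.\<close>

lemma is_invertible_mult_commutingD:
  assumes "is_invertible (x * y)" "x * y = y * x"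
  shows "is_invertible x"
proof -
  obtain z where z: "x * y * z = 1" "z * (x * y) = 1"
    using assms(1) by (auto simp: is_invertible_def)
  have "z * y = z * y * (x * (y * z))"
    using z by (simp add: mult.assoc)
  also have "\<dots> = z * (y * x) * (y * z)"
    by (simp add: mult.assoc)
  also have "\<dots> = y * z"
    using z assms(2) by simp
  finally have "z * y = y * z" .
  with z assms(2) show ?thesis
    unfolding is_invertible_def by (metis mult.assoc)
qed

lemma is_invertible_one_minus:
  fixes x :: "'a::{real_normed_algebra_1,banach}"
  assumes "norm x < 1"
  shows "is_invertible (1 - x)"
proof -
  note S = complete_algebra_summable_geometric[OF assms]
  have "(\<Sum>n. x ^ Suc n) = suminf ((^) x) - 1"
    using suminf_split_head[OF S] by simp
  moreover have "(\<Sum>n. x ^ Suc n) = x * suminf ((^) x)"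
    using suminf_mult[OF S, of x] by simp
  moreover have "(\<Sum>n. x ^ Suc n) = suminf ((^) x) * x"
    using suminf_mult2[OF S, of x] by (simp add: power_commutes)
  ultimately show ?thesis
    unfolding is_invertible_def
    by (intro exI[of _ "suminf ((^) x)"]) (simp add: algebra_simps)
qed

lemma is_invertible_cscale:
  fixes x :: "'a::complex_banach_algebra_1"
  assumes "is_invertible x" "c \<noteq> 0"
  shows "is_invertible (cscale c x)"
proof -
  obtain y where "x * y = 1" "y * x = 1"
    using assms by (auto simp: is_invertible_def)
  then show ?thesis
    unfolding is_invertible_def using assms(2)
    by (intro exI[of _ "cscale (inverse c) y"])
       (simp add: cscale_mult_left_1 cscale_mult_right_1 cscale_cscale cscale_one)
qed

lemma cscale_power:
  fixes x :: "'a::complex_banach_algebra_1"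
  shows "(cscale c x) ^ n = cscale (c ^ n) (x ^ n)"
  by (induction n) (simp_all add: cscale_mult_left_1 cscale_mult_right_1 cscale_cscale cscale_one mult_ac)

lemma one_minus_mult_sum_power:
  fixes y :: "'a::ring_1"
  shows "(1 - y) * (\<Sum>i<m. y ^ i) = 1 - y ^ m"
  by (induction m) (simp_all add: distrib_left left_diff_distrib)

text \<open>The resolvent \<open>R l = (1 - l x)\<inverse>\<close>, averaged over the \<open>m\<close>-th roots of unity, is
  \<open>(1 - x ^ m)\<inverse>\<close>.\<close>
lemma resolvent_average:
  fixes x :: "'a::complex_banach_algebra_1" and m :: nat
  defines "\<omega> \<equiv> \<lambda>j. exp (2 * of_real pi * \<i> * of_nat j / of_nat m)"
  assumes m: "m > 0" and R: "\<And>j. j < m \<Longrightarrow> R j * (1 - cscale (\<omega> j) x) = 1"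
  shows "cscale (1 / of_nat m) (\<Sum>j<m. R j) * (1 - x ^ m) = 1"
proof -
  have \<omega>_pow: "\<omega> j ^ i = \<omega> i ^ j" for i j
    unfolding \<omega>_def by (simp add: exp_of_nat_mult[symmetric] mult_ac)
  have "\<omega> j ^ m = 1" for j
    using complex_root_unity[of m j] m by (simp add: \<omega>_def)
  then have "R j * (1 - x ^ m) = (\<Sum>i<m. cscale (\<omega> j ^ i) (x ^ i))" if "j < m" for j
  proof -
    have "1 - x ^ m = (1 - cscale (\<omega> j) x) * (\<Sum>i<m. cscale (\<omega> j) x ^ i)"
      unfolding one_minus_mult_sum_power
      using \<open>\<And>j. \<omega> j ^ m = 1\<close> by (simp add: cscale_power cscale_one)
    then have "R j * (1 - x ^ m) = (R j * (1 - cscale (\<omega> j) x)) * (\<Sum>i<m. cscale (\<omega> j) x ^ i)"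
      by (simp only: mult.assoc)
    then show ?thesis
      using R that by (simp add: cscale_power)
  qed
  then have "(\<Sum>j<m. R j) * (1 - x ^ m) = (\<Sum>j<m. \<Sum>i<m. cscale (\<omega> j ^ i) (x ^ i))"
    by (simp add: sum_distrib_right)
  also have "\<dots> = (\<Sum>i<m. cscale (\<Sum>j<m. \<omega> i ^ j) (x ^ i))"
    by (subst sum.swap) (simp add: cscale_sum_left \<omega>_pow)
  also have "\<dots> = (\<Sum>i<m. if i = 0 then cscale (of_nat m) 1 else 0)"
  proof (intro sum.cong refl)
    fix i assume i: "i \<in> {..<m}"
    show "cscale (\<Sum>j<m. \<omega> i ^ j) (x ^ i) = (if i = 0 then cscale (of_nat m) 1 else 0)"
    proof (cases "i = 0")
      case True
      then show ?thesis by (simp add: \<omega>_def)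
    next
      case False
      then have "\<omega> i \<noteq> 1"
        using complex_root_unity_eq_1[of m i] m i by (auto simp: \<omega>_def dest: dvd_imp_le)
      then have "(\<Sum>j<m. \<omega> i ^ j) = 0"
        using \<open>\<And>j. \<omega> j ^ m = 1\<close> by (simp add: geometric_sum)
      then show ?thesis using False by simp
    qed
  qed
  also have "\<dots> = cscale (of_nat m) 1"
    using m by (simp add: sum.delta)
  finally show ?thesis
    using m by (simp add: cscale_mult_left_1 cscale_cscale cscale_one)
qed

text \<open>A proof of the spectral radius formula without complex analysis: a resolvent defined on the
  whole closed disc is Lipschitz, so its averages over roots of unity on the unit circle are close
  to those on a slightly smaller circle, and the latter tend to 1.\<close>
lemma exists_not_invertible_on_circle:
  fixes x :: "'a::complex_banach_algebra_1"
  assumes x: "norm x \<le> 1" and pow: "\<And>N. \<exists>m\<ge>N. norm (x ^ m) \<ge> 1"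
  shows "\<exists>l. cmod l = 1 \<and> \<not> is_invertible (1 - cscale l x)"
proof (rule ccontr)
  assume "\<not> ?thesis"
  then have circ: "is_invertible (1 - cscale l x)" if "cmod l = 1" for l
    using that by auto
  have "\<exists>r. (1 - cscale l x) * r = 1 \<and> r * (1 - cscale l x) = 1" if "cmod l \<le> 1" for l
  proof (cases "cmod l = 1")
    case False
    have "norm (cscale l x) \<le> cmod l * 1"
      unfolding norm_cscale_1 using x by (intro mult_left_mono) auto
    with False that have "norm (cscale l x) < 1" by simp
    then show ?thesis
      using is_invertible_one_minus by (auto simp: is_invertible_def)
  qed (use circ in \<open>auto simp: is_invertible_def\<close>)
  then obtain R where R: "\<And>l. cmod l \<le> 1 \<Longrightarrow> (1 - cscale l x) * R l = 1"
      "\<And>l. cmod l \<le> 1 \<Longrightarrow> R l * (1 - cscale l x) = 1"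
    by metis
  \<comment> \<open>The resolvent identity. It yields continuity, hence boundedness on the compact
    disc, and then a Lipschitz estimate.\<close>
  have diff: "norm (R l' - R l) \<le> cmod (l' - l) * norm (R l') * norm (R l)"
    if "cmod l \<le> 1" "cmod l' \<le> 1" for l l'
  proof -
    have "R l' - R l = R l' * ((1 - cscale l x) * R l) - (R l' * (1 - cscale l' x)) * R l"
      using R that by simp
    also have "\<dots> = R l' * cscale (l' - l) x * R l"
      by (simp add: algebra_simps cscale_diff_left)
    finally have "R l' - R l = R l' * cscale (l' - l) x * R l" .
    then have "norm (R l' - R l) \<le> norm (R l') * norm (cscale (l' - l) x) * norm (R l)"
      by (simp only:) (intro order_trans[OF norm_mult_ineq] mult_right_mono norm_mult_ineq norm_ge_zero)
    also have "\<dots> \<le> norm (R l') * cmod (l' - l) * norm (R l)"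
      using x by (intro mult_right_mono mult_left_mono) (auto simp: norm_cscale_1 mult_left_le)
    finally show ?thesis by (simp add: mult_ac)
  qed
  have "continuous_on (cball 0 1) R"
  proof (rule continuous_onI)
    fix l e assume l: "l \<in> cball (0::complex) 1" and e: "(e::real) > 0"
    define \<rho> where "\<rho> = norm (R l) + 1"
    have \<rho>: "\<rho> \<ge> 1" "norm (R l) \<le> \<rho>" by (auto simp: \<rho>_def)
    \<comment> \<open>The first bound lets half of \<open>norm (R l')\<close> be absorbed, so that
      it is at most \<open>2 * \<rho>\<close>; the second then yields \<open>e\<close>.\<close>
    define d where "d = min (1 / (2 * \<rho>)) (e / (4 * \<rho> * \<rho>))"
    have "d > 0" using e \<rho> by (auto simp: d_def)
    moreover have "dist (R l') (R l) \<le> e" if l': "l' \<in> cball 0 1" "dist l' l < d" for l'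
    proof -
      let ?r = "norm (R l')"
      have dle: "cmod (l' - l) \<le> d"
        using l'(2) by (simp add: dist_norm)
      have "cmod (l' - l) * ?r * norm (R l) \<le> cmod (l' - l) * ?r * \<rho>"
        using \<rho> by (intro mult_left_mono) auto
      with diff[of l l'] l l' have D: "norm (R l' - R l) \<le> cmod (l' - l) * ?r * \<rho>"
        by simp
      also have "\<dots> \<le> (1 / (2 * \<rho>)) * ?r * \<rho>"
        using dle \<rho> by (intro mult_right_mono) (auto simp: d_def)
      also have "\<dots> = ?r / 2" using \<rho> by simp
      finally have "?r \<le> 2 * \<rho>"
        using norm_triangle_ineq2[of "R l'" "R l"] \<rho> by linarith
      then have "cmod (l' - l) * ?r * \<rho> \<le> (e / (4 * \<rho> * \<rho>)) * (2 * \<rho>) * \<rho>"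
        using dle \<rho> e by (intro mult_mono) (auto simp: d_def)
      also have "\<dots> \<le> e" using \<rho> e by simp
      finally show ?thesis using D by (simp add: dist_norm)
    qed
    ultimately show "\<exists>d>0. \<forall>l'\<in>cball 0 1. dist l' l < d \<longrightarrow> dist (R l') (R l) \<le> e"
      by auto
  qed
  then have "bounded (R ` cball 0 1)"
    by (intro compact_imp_bounded compact_continuous_image compact_cball)
  then obtain \<rho> where \<rho>: "\<rho> > 0" "\<And>l. cmod l \<le> 1 \<Longrightarrow> norm (R l) \<le> \<rho>"
    unfolding bounded_pos by auto
  \<comment> \<open>The average over the circle of radius \<open>t\<close>, a left inverse of 1 - (t
    x)^m.\<close>
  define Q where "Q t m = cscale (1 / of_nat m)
      (\<Sum>j<m. R (complex_of_real t * exp (2 * of_real pi * \<i> * of_nat j / of_nat m)))"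
    for t :: real and m :: nat
  have lin: "cmod (complex_of_real t * exp (2 * of_real pi * \<i> * of_nat j / of_nat m)) \<le> 1"
    if "0 \<le> t" "t \<le> 1" for t j m
    using that by (simp add: norm_mult)
  have Q: "Q t m * (1 - cscale (of_real (t ^ m)) (x ^ m)) = 1" if "0 \<le> t" "t \<le> 1" "m > 0" for t m
    unfolding Q_def of_real_power cscale_power[symmetric]
  proof (rule resolvent_average)
    fix j
    show "R (of_real t * exp (2 * of_real pi * \<i> * of_nat j / of_nat m)) *
        (1 - cscale (exp (2 * of_real pi * \<i> * of_nat j / of_nat m)) (cscale (of_real t) x)) = 1"
      unfolding cscale_cscale using R(2)[OF lin[OF that(1,2), of j m]]
      by (subst mult.commute[of "exp _"])
  qed (fact that(3))
  have avg: "norm (cscale (1 / of_nat m) (\<Sum>j<m. f j)) \<le> c"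
    if "m > 0" "\<And>j. j < m \<Longrightarrow> norm (f j) \<le> c" for f :: "nat \<Rightarrow> 'a" and c and m :: nat
  proof -
    have "norm (\<Sum>j<m. f j) \<le> real m * c"
      using sum_norm_bound[of "{..<m}" f c] that by simp
    then show ?thesis using that
      by (simp add: norm_cscale_1 norm_divide field_simps)
  qed
  \<comment> \<open>Chosen so that \<open>\<rho>\<^sup>2 * (1 - t)\<close>, the Lipschitz bound for
    passing from radius 1 to radius \<open>t\<close>, is at most 1/8.\<close>
  define t where "t = 1 - 1 / (8 * \<rho>\<^sup>2 + 1)"
  have pos: "8 * \<rho>\<^sup>2 + 1 > 0" by (simp add: add_nonneg_pos)
  then have t: "0 \<le> t" "t < 1" by (auto simp: t_def divide_le_eq)
  have "\<rho>\<^sup>2 * (1 - t) \<le> 1 / 8"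
    using pos by (simp add: t_def divide_le_eq)
  have "(\<lambda>m. \<rho> * t ^ m) \<longlonglongrightarrow> \<rho> * 0"
    using t by (intro tendsto_mult tendsto_const LIMSEQ_realpow_zero) auto
  then have "\<forall>\<^sub>F m in sequentially. \<rho> * t ^ m < 1 / 8"
    by (rule order_tendstoD) simp
  then obtain N where N: "\<And>m. m \<ge> N \<Longrightarrow> \<rho> * t ^ m < 1 / 8"
    by (auto simp: eventually_sequentially)
  obtain m where m: "m \<ge> Suc N" "norm (x ^ m) \<ge> 1"
    using pow by blast
  have "norm (x ^ m) \<le> 1"
    using x norm_power_ineq[of x m] power_le_one[of "norm x" m] by (meson norm_ge_zero order_trans)
  have "Q t m - 1 = Q t m * cscale (of_real (t ^ m)) (x ^ m)"
    using Q[of t m] t m by (simp add: algebra_simps)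
  then have "norm (Q t m - 1) \<le> norm (Q t m) * (t ^ m * norm (x ^ m))"
    using norm_mult_ineq[of "Q t m" "cscale (of_real (t ^ m)) (x ^ m)"] t
    by (simp add: norm_cscale_1 norm_power)
  also have "\<dots> \<le> \<rho> * (t ^ m * 1)"
    using t \<open>norm (x ^ m) \<le> 1\<close> \<rho>(1) m unfolding Q_def
    by (intro mult_mono avg \<rho>(2) lin) auto
  also have "\<dots> < 1 / 8" using N m by simp
  finally have near1: "norm (Q t m - 1) < 1 / 8" .
  have "Q 1 m - Q t m = cscale (1 / of_nat m)
      (\<Sum>j<m. R (of_real 1 * exp (2 * of_real pi * \<i> * of_nat j / of_nat m))
        - R (of_real t * exp (2 * of_real pi * \<i> * of_nat j / of_nat m)))"
    by (simp add: Q_def cscale_diff_right sum_subtractf)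
  also have "norm \<dots> \<le> 1 / 8"
  proof (rule avg)
    show "m > 0" using m by simp
    fix j
    let ?z = "exp (2 * of_real pi * \<i> * of_nat j / of_nat m)"
    have "of_real 1 * ?z - of_real t * ?z = of_real (1 - t) * ?z"
      by (simp add: algebra_simps)
    then have "cmod (of_real 1 * ?z - of_real t * ?z) = 1 - t"
      using t by (simp only: norm_mult norm_of_real) simp
    then have "norm (R (of_real 1 * ?z) - R (of_real t * ?z))
        \<le> (1 - t) * norm (R (of_real 1 * ?z)) * norm (R (of_real t * ?z))"
      using diff[of "of_real t * ?z" "of_real 1 * ?z"] lin[of t j m] lin[of 1 j m] t by auto
    also have "\<dots> \<le> (1 - t) * \<rho> * \<rho>"
      using t \<rho>(1) lin[of t j m] lin[of 1 j m] by (intro mult_mono \<rho>(2)) auto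
    also have "\<dots> \<le> 1 / 8" using \<open>\<rho>\<^sup>2 * (1 - t) \<le> 1 / 8\<close> by (simp add: power2_eq_square mult_ac)
    finally show "norm (R (of_real 1 * ?z) - R (of_real t * ?z)) \<le> 1 / 8" .
  qed
  finally have q: "norm (Q 1 m - 1) < 1 / 4"
    using near1 norm_triangle_ineq[of "Q 1 m - Q t m" "Q t m - 1"] by simp
  \<comment> \<open>A rearrangement of \<open>Q 1 m * (1 - x ^ m) = 1\<close>. As
    \<open>Q 1 m\<close> is within 1/4 of 1, it bounds \<open>norm (x ^ m)\<close> by 1/2.\<close>
  have "x ^ m = (Q 1 m - 1) - (Q 1 m - 1) * x ^ m"
    using Q[of 1 m] m by (simp add: algebra_simps cscale_one)
  then have "norm (x ^ m) \<le> norm (Q 1 m - 1) + norm ((Q 1 m - 1) * x ^ m)"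
    by (metis norm_triangle_ineq4)
  also have "\<dots> \<le> norm (Q 1 m - 1) + norm (Q 1 m - 1) * norm (x ^ m)"
    by (intro add_left_mono norm_mult_ineq)
  also have "\<dots> \<le> 1 / 4 + 1 / 4 * 1"
    using q \<open>norm (x ^ m) \<le> 1\<close> by (intro add_mono mult_mono) auto
  finally show False using m by simp
qed

section \<open>Polynomials and characters\<close>

definition peval :: "complex poly \<Rightarrow> 'a::complex_banach_algebra_1 \<Rightarrow> 'a" where
  "peval p x = fold_coeffs (\<lambda>a y. cscale a 1 + x * y) p 0"

lemma peval_0 [simp]: "peval 0 x = 0"
  by (simp add: peval_def)

lemma peval_pCons [simp]: "peval (pCons a p) x = cscale a 1 + x * peval p x"
  by (cases "p = 0 \<and> a = 0") (auto simp: peval_def)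

lemma peval_1 [simp]: "peval 1 x = 1"
  by (simp add: one_pCons cscale_one)

lemma peval_add: "peval (p + q) x = peval p x + peval q x"
  by (induction p q rule: poly_induct2) (simp_all add: cscale_add_left distrib_left add_ac)

lemma peval_smult: "peval (smult c p) x = cscale c (peval p x)"
  by (induction p) (simp_all add: cscale_add_right cscale_cscale cscale_mult_right_1)

lemma peval_diff: "peval (p - q) x = peval p x - peval q x"
  using peval_add[of p "smult (- 1) q" x] peval_smult[of "- 1" q x] by (simp add: cscale_one)

lemma peval_mult: "peval (p * q) x = peval p x * peval q x"
  by (induction p)
     (simp_all add: peval_add peval_smult distrib_right cscale_mult_left_1 mult.assoc)

lemma peval_commute: "peval p x * peval q x = peval q x * peval p x"
  by (metis mult.commute peval_mult)

text \<open>If p(l) exceeded the norm of p(x), then p(x) - p(l) would be invertible by a Neumann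
  series. It has the factor x - l, which commutes with the cofactor and so would be invertible
  too.\<close>

lemma cmod_poly_le_norm_peval:
  assumes "\<not> is_invertible (x - cscale l 1)"
  shows "cmod (poly p l) \<le> norm (peval p x)"
proof (rule ccontr)
  define c where "c = poly p l"
  assume "\<not> ?thesis"
  then have less: "norm (peval p x) < cmod c" by (simp add: c_def)
  then have "c \<noteq> 0" by auto
  with less have "norm (cscale (1 / c) (peval p x)) < 1"
    by (simp add: norm_cscale_1 norm_divide)
  then have "is_invertible (cscale (- c) (1 - cscale (1 / c) (peval p x)))"
    using \<open>c \<noteq> 0\<close> is_invertible_cscale is_invertible_one_minus neg_equal_0_iff_equal by blast
  moreover have "cscale (- c) (1 - cscale (1 / c) (peval p x)) = peval (p - [:c:]) x"
    using \<open>c \<noteq> 0\<close> by (simp add: peval_diff cscale_diff_right cscale_cscale cscale_one)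
  moreover have "[:- l, 1:] dvd p - [:c:]"
    by (simp add: poly_eq_0_iff_dvd[symmetric] c_def)
  then obtain q where "p - [:c:] = [:- l, 1:] * q" by blast
  ultimately have "is_invertible (peval [:- l, 1:] x * peval q x)"
    by (simp only: peval_mult)
  then have "is_invertible (peval [:- l, 1:] x)"
    by (rule is_invertible_mult_commutingD) (rule peval_commute)
  then show False using assms by (simp add: cscale_one)
qed

text \<open>Split \<open>q\<close> into linear factors: if all of them were invertible at
  \<open>x\<close>, so would be their product.\<close>

lemma exists_root_not_invertible:
  fixes x :: "'a::complex_banach_algebra_1"
  assumes "\<not> is_invertible (peval q x)" "q \<noteq> 0"
  shows "\<exists>l. poly q l = 0 \<and> \<not> is_invertible (x - cscale l 1)"
  using assms
proof (induction "degree q" arbitrary: q)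
  case 0
  then obtain c where "q = [:c:]" "c \<noteq> 0"
    by (metis degree_eq_zeroE pCons_0_0)
  moreover have "is_invertible (1 :: 'a)" by (auto simp: is_invertible_def)
  ultimately show ?case using 0 is_invertible_cscale by fastforce
next
  case (Suc n)
  then have "\<not> constant (poly q)"
    using constant_degree by (metis nat.distinct(1))
  then obtain l where l: "poly q l = 0"
    using fundamental_theorem_of_algebra by blast
  then obtain r where r: "q = [:- l, 1:] * r"
    by (metis dvdE poly_eq_0_iff_dvd)
  show ?case
  proof (cases "is_invertible (x - cscale l 1)")
    case True
    then have "\<not> is_invertible (peval r x)"
      using Suc.prems(1) is_invertible_mult[of "peval [:- l, 1:] x" "peval r x"]
      unfolding r peval_mult by (auto simp: cscale_one)
    moreover have "r \<noteq> 0" using Suc.prems r by auto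
    moreover have "n = degree r"
      using Suc.hyps(2) \<open>r \<noteq> 0\<close> unfolding r by (subst (asm) degree_mult_eq) auto
    ultimately obtain l' where "poly r l' = 0" "\<not> is_invertible (x - cscale l' 1)"
      using Suc.hyps(1) by blast
    then show ?thesis using r by auto
  qed (use l in auto)
qed

section \<open>Spectrum of a self-adjoint element and characters on its polynomials\<close>

lemma norm_invol [simp]: "norm (invol x) = norm (x::'a::cstar_algebra)"
proof -
  have "norm y \<le> norm (invol y)" for y :: 'a
  proof (cases "norm y = 0")
    case False
    have "norm y * norm y \<le> norm (invol y) * norm y"
      using norm_mult_ineq[of "invol y" y] by (simp add: cstar_identity power2_eq_square)
    then show ?thesis using False by (simp add: mult_le_cancel_right)
  qed simp
  from this[of x] this[of "invol x"] show ?thesis by (simp add: invol_invol)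
qed

lemma invol_zero [simp]: "invol (0::'a::cstar_algebra) = 0"
  by (metis add_cancel_right_right invol_add)

definition unit_invol :: "'a::cstar_algebra unitization \<Rightarrow> 'a unitization" where
  "unit_invol x = Unitization (invol (element x)) (cnj (scalar x))"

text \<open>The involution reverses products, so the Horner step needs values that commute with
  \<open>b\<close>; polynomials in \<open>b\<close> do.\<close>

lemma peval_cnj:
  fixes b :: "'a::cstar_algebra"
  assumes "invol b = b"
  shows "peval (map_poly cnj p) (Unitization b 0) = unit_invol (peval p (Unitization b 0))"
proof (induction p)
  case (pCons a p)
  have "unit_invol (cscale a 1 + Unitization b 0 * y)
      = cscale (cnj a) 1 + Unitization b 0 * unit_invol y" if "y * Unitization b 0 = Unitization b 0 * y" for y
  proof -
    have "element y * b = b * element y"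
      using that by (simp add: times_unitization_def add_ac)
    then have "b * invol (element y) = invol (element y) * b"
      by (metis assms invol_mult)
    then show ?thesis
      by (simp add: unit_invol_def unitization_defs invol_add invol_mult invol_cscale assms)
  qed
  moreover have "peval p (Unitization b 0) * Unitization b 0 = Unitization b 0 * peval p (Unitization b 0)"
    using peval_commute[of p "Unitization b 0" "[:0, 1:]"] by (simp add: cscale_one)
  ultimately show ?case using pCons by (simp add: map_poly_pCons)
qed (simp add: unit_invol_def unitization_defs)

lemma scalar_peval: "scalar (peval p (Unitization b 0)) = poly p 0"
  for b :: "'a::cstar_algebra"
  by (induction p) (simp_all add: unitization_defs)

text \<open>For self-adjoint g the C*-identity says that the norm of g^2 is the square of the norm
  of g. Repeated squaring reaches arbitrarily large exponents, which is all that
  \<open>exists_not_invertible_on_circle\<close> asks for.\<close>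

lemma self_adjoint_power_two_power:
  fixes h :: "'a::cstar_algebra"
  assumes "invol h = h" "norm h = 1"
  shows "norm (Unitization h 0 ^ (2 ^ l)) = 1"
proof -
  have "\<exists>g. Unitization h 0 ^ (2 ^ l) = Unitization g 0 \<and> invol g = g \<and> norm g = 1"
  proof (induction l)
    case (Suc l)
    then obtain g where g: "Unitization h 0 ^ (2 ^ l) = Unitization g 0" "invol g = g" "norm g = 1"
      by blast
    have "Unitization h 0 ^ (2 ^ Suc l) = Unitization g 0 * Unitization g 0"
      using g(1) by (simp add: power_mult power2_eq_square mult.commute[of 2])
    then show ?case
      using g cstar_identity[of g] by (intro exI[of _ "g * g"]) (simp add: unitization_defs invol_mult)
  qed (use assms in auto)
  then show ?thesis by (auto simp: norm_unitization_def)
qed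

lemma self_adjoint_not_invertible:
  fixes h :: "'a::cstar_algebra"
  assumes "invol h = h" "norm h = 1"
  shows "\<exists>l. cmod l = 1 \<and> \<not> is_invertible (1 - cscale l (Unitization h 0))"
proof (rule exists_not_invertible_on_circle)
  show "norm (Unitization h 0) \<le> 1"
    using assms by (simp add: norm_unitization_def)
  show "\<exists>m\<ge>N. 1 \<le> norm (Unitization h 0 ^ m)" for N
    using self_adjoint_power_two_power[OF assms, of N] less_exp[of N]
    by (intro exI[of _ "2 ^ N"]) auto
qed

text \<open>Intended for polynomials without constant term: their values in the unitization have
  scalar part 0, so dropping it loses nothing.\<close>

definition pelt :: "'a::cstar_algebra \<Rightarrow> complex poly \<Rightarrow> 'a" where
  "pelt b p = element (peval p (Unitization b 0))"

lemma peval_eq_pelt: "poly p 0 = 0 \<Longrightarrow> peval p (Unitization b 0) = Unitization (pelt b p) 0"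
  using scalar_peval[of p b] by (simp add: pelt_def unitization.expand)

lemma pelt_simps:
  assumes "poly p 0 = 0" "poly q 0 = 0"
  shows "pelt b (p + q) = pelt b p + pelt b q" "pelt b (p - q) = pelt b p - pelt b q"
    "pelt b (p * q) = pelt b p * pelt b q" "pelt b (smult c p) = cscale c (pelt b p)"
    "norm (peval p (Unitization b 0)) = norm (pelt b p)"
  using scalar_peval[of p b] scalar_peval[of q b] assms
  by (simp_all add: pelt_def peval_add peval_diff peval_mult peval_smult unitization_defs)

text \<open>Evaluation at a suitable spectral point l of \<open>b\<close> is contractive and attains
  the norm of p(b). To find l, normalise p(b)* p(b) to a self-adjoint \<open>h\<close> of norm 1 and
  pull a unimodular spectral value of \<open>h\<close> back to \<open>b\<close>. Then |p'(l)| |p(l)|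
  is the square of r = \<open>norm (pelt b p)\<close>, and neither factor exceeds r.\<close>

lemma exists_poly_character:
  fixes b :: "'a::cstar_algebra"
  assumes b: "invol b = b" and p0: "poly p 0 = 0" and nz: "pelt b p \<noteq> 0"
  shows "\<exists>l. (\<forall>r. poly r 0 = 0 \<longrightarrow> cmod (poly r l) \<le> norm (pelt b r)) \<and> cmod (poly p l) = norm (pelt b p)"
proof -
  define r where "r = norm (pelt b p)"
  have r: "r > 0" using nz by (simp add: r_def)
  define p' where "p' = map_poly cnj p"
  have p'0: "poly p' 0 = 0"
    using p0 by (simp add: p'_def poly_0_coeff_0 coeff_map_poly)
  have p': "pelt b p' = invol (pelt b p)"
    using peval_cnj[OF b, of p] by (simp add: p'_def pelt_def unit_invol_def)
  define h where "h = cscale (of_real (1 / r\<^sup>2)) (pelt b (p' * p))"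
  have h': "pelt b (p' * p) = invol (pelt b p) * pelt b p"
    by (simp add: pelt_simps p0 p'0 p')
  have "invol h = h"
    unfolding h_def h' by (simp add: invol_cscale invol_mult invol_invol)
  moreover have "norm h = 1"
    unfolding h_def h' norm_cscale cstar_identity using r by (simp add: r_def norm_divide norm_power)
  ultimately obtain c where c: "cmod c = 1" "\<not> is_invertible (1 - cscale c (Unitization h 0))"
    using self_adjoint_not_invertible by blast
  \<comment> \<open>Makes \<open>1 - cscale c h\<close> a polynomial in \<open>b\<close>. Its
    constant term is 1, so it is nonzero and the root lemma applies.\<close>
  define q where "q = 1 - smult (c * of_real (1 / r\<^sup>2)) (p' * p)"
  have "peval q (Unitization b 0) = 1 - cscale c (Unitization h 0)"
    unfolding q_def peval_diff peval_smult
    by (subst peval_eq_pelt) (simp_all add: p0 h_def cscale_unitization_def cscale_cscale)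
  moreover have "poly q 0 = 1" by (simp add: q_def p0)
  then have "q \<noteq> 0" by auto
  ultimately obtain l where l: "poly q l = 0" "\<not> is_invertible (Unitization b 0 - cscale l 1)"
    using c exists_root_not_invertible by metis
  have le: "cmod (poly s l) \<le> norm (pelt b s)" if "poly s 0 = 0" for s
    using cmod_poly_le_norm_peval[OF l(2), of s] that pelt_simps(5)[of s s b] by simp
  have "c * of_real (1 / r\<^sup>2) * (poly p' l * poly p l) = 1"
    using l(1) by (simp add: q_def)
  then have "cmod c * (1 / r\<^sup>2) * (cmod (poly p' l) * cmod (poly p l)) = 1"
    by (metis abs_of_nonneg norm_mult norm_of_real norm_one zero_le_divide_1_iff zero_le_power2)
  then have "r * r = cmod (poly p' l) * cmod (poly p l)"
    using c r by (simp add: field_simps power2_eq_square)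
  also have "\<dots> \<le> r * cmod (poly p l)"
    using le[OF p'0] by (intro mult_right_mono) (auto simp: p' r_def)
  finally have "cmod (poly p l) = norm (pelt b p)"
    using r le[OF p0] by (simp add: r_def mult_le_cancel_left)
  with le show ?thesis by blast
qed

text \<open>Choose p(b) within \<open>norm d / 2\<close> of \<open>d\<close> and a point l attaining
  the norm of p(b). Evaluation at l is contractive, so it extends to the closure, and its value at
  \<open>d\<close> is closer to p(l) than p(l) is to 0.\<close>

lemma exists_separating_character:
  fixes b :: "'a::cstar_algebra"
  defines "P \<equiv> {pelt b p |p. poly p 0 = 0}"
  assumes b: "invol b = b" and d: "d \<in> closure P" "d \<noteq> 0"
  shows "\<exists>\<phi>. (\<forall>x\<in>closure P. \<forall>y\<in>closure P. \<phi> (x + y) = \<phi> x + \<phi> y \<and> \<phi> (x * y) = \<phi> x * \<phi> y)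
     \<and> (\<forall>c. \<forall>x\<in>closure P. \<phi> (cscale c x) = c * \<phi> x) \<and> \<phi> d \<noteq> (0::complex)"
proof -
  obtain p where p: "poly p 0 = 0" "dist (pelt b p) d < norm d / 2"
    using d(1)[unfolded closure_approachable, rule_format, of "norm d / 2"] d(2)
    unfolding P_def by auto
  have np: "norm (pelt b p) > norm d / 2"
    using p(2) norm_triangle_ineq2[of d "pelt b p"] by (simp add: dist_norm norm_minus_commute)
  then have "pelt b p \<noteq> 0"
    using norm_ge_zero[of d] by (metis divide_nonneg_pos norm_zero not_less zero_less_numeral)
  then obtain l where l: "\<And>r. poly r 0 = 0 \<Longrightarrow> cmod (poly r l) \<le> norm (pelt b r)"
      "cmod (poly p l) = norm (pelt b p)"
    using exists_poly_character[OF b p(1)] by blast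
  have l': "cmod (poly r l - poly s l) \<le> norm (pelt b r - pelt b s)"
    if "poly r 0 = 0" "poly s 0 = 0" for r s
    using l(1)[of "r - s"] that by (simp add: pelt_simps)
  have "\<exists>q. \<forall>m. poly (q m) 0 = 0 \<and> (\<lambda>m. pelt b (q m)) \<longlonglongrightarrow> x" if x: "x \<in> closure P" for x
  proof -
    obtain f where f: "\<And>m. f m \<in> P" "f \<longlonglongrightarrow> x"
      using x unfolding closure_sequential by blast
    then have "\<forall>m. \<exists>q. poly q 0 = 0 \<and> f m = pelt b q" by (auto simp: P_def)
    then obtain q where "\<And>m. poly (q m) 0 = 0 \<and> f m = pelt b (q m)" by metis
    moreover from this have "f = (\<lambda>m. pelt b (q m))" by auto
    ultimately show ?thesis using f by blast
  qed
  then obtain Q where Q: "\<And>x m. x \<in> closure P \<Longrightarrow> poly (Q x m) 0 = 0"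
      "\<And>x. x \<in> closure P \<Longrightarrow> (\<lambda>m. pelt b (Q x m)) \<longlonglongrightarrow> x"
    by metis
  define \<phi> where "\<phi> x = lim (\<lambda>m. poly (Q x m) l)" for x
  have Q\<phi>: "(\<lambda>m. poly (Q x m) l) \<longlonglongrightarrow> \<phi> x" if x: "x \<in> closure P" for x
  proof -
    have "Cauchy (\<lambda>m. pelt b (Q x m))"
      using Q(2)[OF x] by (rule LIMSEQ_imp_Cauchy)
    then have "Cauchy (\<lambda>m. poly (Q x m) l)"
      unfolding Cauchy_def dist_norm by (meson Q(1)[OF x] l' order_le_less_trans)
    then show ?thesis
      unfolding \<phi>_def using Cauchy_convergent convergent_LIMSEQ_iff by blast
  qed
  have in_closure: "x \<in> closure P" if "\<And>m. poly (q m) 0 = 0" "(\<lambda>m. pelt b (q m)) \<longlonglongrightarrow> x" for x q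
    unfolding closure_sequential using that by (intro exI[of _ "\<lambda>m. pelt b (q m)"]) (auto simp: P_def)
  \<comment> \<open>Independence of the approximating polynomials: sums, products and multiples may
    then be computed along any convenient sequence.\<close>
  have lim: "\<phi> x = z"
    if q: "\<And>m. poly (q m) 0 = 0" "(\<lambda>m. pelt b (q m)) \<longlonglongrightarrow> x"
      "(\<lambda>m. poly (q m) l) \<longlonglongrightarrow> z" for x q z
  proof -
    have x: "x \<in> closure P" using in_closure q by blast
    have "(\<lambda>m. pelt b (Q x m) - pelt b (q m)) \<longlonglongrightarrow> x - x"
      by (intro tendsto_diff Q x q)
    then have "(\<lambda>m. norm (pelt b (Q x m) - pelt b (q m))) \<longlonglongrightarrow> 0"
      by (simp add: tendsto_norm_zero)
    then have "(\<lambda>m. poly (Q x m) l - poly (q m) l) \<longlonglongrightarrow> 0"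
      by (rule Lim_null_comparison[rotated]) (simp add: l' Q(1)[OF x] q(1))
    moreover have "(\<lambda>m. poly (Q x m) l - poly (q m) l) \<longlonglongrightarrow> \<phi> x - z"
      by (intro tendsto_diff Q\<phi> x q)
    ultimately show ?thesis using LIMSEQ_unique by fastforce
  qed
  have "\<phi> (x + y) = \<phi> x + \<phi> y" "\<phi> (x * y) = \<phi> x * \<phi> y" if x: "x \<in> closure P" and y: "y \<in> closure P" for x y
  proof -
    have "(\<lambda>m. pelt b (Q x m + Q y m)) \<longlonglongrightarrow> x + y" "(\<lambda>m. pelt b (Q x m * Q y m)) \<longlonglongrightarrow> x * y"
      using tendsto_add[OF Q(2)[OF x] Q(2)[OF y]] tendsto_mult[OF Q(2)[OF x] Q(2)[OF y]]
      by (simp_all add: pelt_simps Q(1) x y)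
    then show "\<phi> (x + y) = \<phi> x + \<phi> y" "\<phi> (x * y) = \<phi> x * \<phi> y"
      using lim[of "\<lambda>m. Q x m + Q y m" "x + y" "\<phi> x + \<phi> y"]
        lim[of "\<lambda>m. Q x m * Q y m" "x * y" "\<phi> x * \<phi> y"]
        tendsto_add[OF Q\<phi>[OF x] Q\<phi>[OF y]] tendsto_mult[OF Q\<phi>[OF x] Q\<phi>[OF y]]
      by (simp_all add: Q(1) x y)
  qed
  moreover have "\<phi> (cscale c x) = c * \<phi> x" if x: "x \<in> closure P" for c x
  proof -
    have "bounded_linear (cscale c :: 'a \<Rightarrow> 'a)"
      by (rule bounded_linear_intro[where K = "cmod c"])
         (auto simp: cscale_add_right scaleR_cscale cscale_cscale mult_ac norm_cscale)
    then have "(\<lambda>m. cscale c (pelt b (Q x m))) \<longlonglongrightarrow> cscale c x"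
      using Q(2)[OF x] by (rule bounded_linear.tendsto)
    then have "(\<lambda>m. pelt b (smult c (Q x m))) \<longlonglongrightarrow> cscale c x"
      by (simp add: pelt_simps(4)[of _ 0] Q(1) x)
    then show ?thesis
      using lim[of "\<lambda>m. smult c (Q x m)" "cscale c x" "c * \<phi> x"]
        tendsto_mult[OF tendsto_const[of c] Q\<phi>[OF x]] by (simp add: Q(1) x)
  qed
  moreover have "\<phi> d \<noteq> 0"
  proof -
    have "cmod (\<phi> d - poly p l) \<le> norm (d - pelt b p)"
      by (rule tendsto_le[OF _ tendsto_norm[OF tendsto_diff[OF Q(2)[OF d(1)] tendsto_const]]
            tendsto_norm[OF tendsto_diff[OF Q\<phi>[OF d(1)] tendsto_const]]])
         (auto intro!: always_eventually l' Q(1) d p)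
    also have "\<dots> < cmod (poly p l)"
      using p(2) np l(2) by (simp add: dist_norm norm_minus_commute)
    finally show ?thesis by auto
  qed
  ultimately show ?thesis by (intro exI[of _ \<phi>]) blast
qed

section \<open>Rapidly decaying bump functions\<close>

text \<open>Multiplication of cosine coefficients by \<open>c\<close> is a generalised averaging over translates by
  at most \<open>r\<close>.\<close>
definition averaging :: "(nat \<Rightarrow> real) \<Rightarrow> real \<Rightarrow> bool" where
  "averaging c r \<longleftrightarrow> (\<forall>N. \<bar>c N\<bar> \<le> 1) \<and> (\<forall>h t e. summable (\<lambda>N. \<bar>h N\<bar>)
     \<longrightarrow> (\<forall>s. \<bar>s\<bar> \<le> r \<longrightarrow> \<bar>\<Sum>N. h N * cos (real N * (t + s))\<bar> \<le> e)
     \<longrightarrow> \<bar>\<Sum>N. c N * h N * cos (real N * t)\<bar> \<le> e)"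

lemma averagingD:
  assumes "averaging c r" "summable (\<lambda>N. \<bar>h N\<bar>)"
    "\<And>s. \<bar>s\<bar> \<le> r \<Longrightarrow> \<bar>\<Sum>N. h N * cos (real N * (t + s))\<bar> \<le> e"
  shows "\<bar>\<Sum>N. c N * h N * cos (real N * t)\<bar> \<le> e"
  using assms unfolding averaging_def by blast

lemma averaging_le_1: "averaging c r \<Longrightarrow> \<bar>c N\<bar> \<le> 1"
  by (simp add: averaging_def)

lemma summable_mult_cos:
  fixes h :: "nat \<Rightarrow> real"
  assumes "summable (\<lambda>N. \<bar>h N\<bar>)"
  shows "summable (\<lambda>N. h N * cos (f N))"
  by (rule summable_comparison_test'[OF assms, of 0]) (simp add: abs_mult mult_left_le)

lemma averaging_mono: "averaging c r \<Longrightarrow> r \<le> r' \<Longrightarrow> averaging c r'"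
  unfolding averaging_def by (meson order_trans)

lemma averaging_one: "averaging (\<lambda>_. 1) 0"
  by (simp add: averaging_def)

text \<open>The mean of the translates by \<open>b\<close> and \<open>- b\<close>.\<close>

lemma averaging_cos: "averaging (\<lambda>N. cos (b * real N)) \<bar>b\<bar>"
  unfolding averaging_def
proof (intro conjI allI impI)
  fix h :: "nat \<Rightarrow> real" and t e :: real
  assume h: "summable (\<lambda>N. \<bar>h N\<bar>)"
    and le: "\<forall>s. \<bar>s\<bar> \<le> \<bar>b\<bar> \<longrightarrow> \<bar>\<Sum>N. h N * cos (real N * (t + s))\<bar> \<le> e"
  have "cos (b * real N) * h N * cos (real N * t)
      = (h N * cos (real N * (t + b)) + h N * cos (real N * (t + - b))) / 2" for N
    by (simp add: algebra_simps cos_add cos_diff)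
  then have "(\<Sum>N. cos (b * real N) * h N * cos (real N * t))
      = ((\<Sum>N. h N * cos (real N * (t + b))) + (\<Sum>N. h N * cos (real N * (t + - b)))) / 2"
    by (simp only: suminf_divide suminf_add summable_add summable_mult_cos[OF h])
  moreover have "\<bar>\<Sum>N. h N * cos (real N * (t + b))\<bar> \<le> e" "\<bar>\<Sum>N. h N * cos (real N * (t + - b))\<bar> \<le> e"
    using le[rule_format, of b] le[rule_format, of "- b"] by simp_all
  moreover have "\<bar>x\<bar> \<le> e \<Longrightarrow> \<bar>y\<bar> \<le> e \<Longrightarrow> \<bar>(x + y) / 2\<bar> \<le> e" for x y :: real
    by (auto simp: abs_le_iff field_simps)
  ultimately show "\<bar>\<Sum>N. cos (b * real N) * h N * cos (real N * t)\<bar> \<le> e"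
    by (simp only:)
qed simp

text \<open>Averaging twice convolves the weights: multipliers multiply and widths add.\<close>

lemma averaging_mult:
  assumes c: "averaging c r" and d: "averaging d r'"
  shows "averaging (\<lambda>N. c N * d N) (r + r')"
  unfolding averaging_def
proof (intro conjI allI impI)
  show "\<bar>c N * d N\<bar> \<le> 1" for N
    using averaging_le_1[OF c] averaging_le_1[OF d] by (simp add: abs_mult mult_le_one)
next
  fix h :: "nat \<Rightarrow> real" and t e :: real
  assume h: "summable (\<lambda>N. \<bar>h N\<bar>)"
    and le: "\<forall>s. \<bar>s\<bar> \<le> r + r' \<longrightarrow> \<bar>\<Sum>N. h N * cos (real N * (t + s))\<bar> \<le> e"
  have "summable (\<lambda>N. \<bar>d N * h N\<bar>)"
    by (rule summable_comparison_test'[OF h, of 0])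
       (use averaging_le_1[OF d] in \<open>simp add: abs_mult mult_left_le_one_le\<close>)
  then have "\<bar>\<Sum>N. c N * (d N * h N) * cos (real N * t)\<bar> \<le> e"
  proof (rule averagingD[OF c])
    fix s :: real assume s: "\<bar>s\<bar> \<le> r"
    show "\<bar>\<Sum>N. d N * h N * cos (real N * (t + s))\<bar> \<le> e"
      by (rule averagingD[OF d h]) (use s le in \<open>auto simp: add.assoc\<close>)
  qed
  then show "\<bar>\<Sum>N. c N * d N * h N * cos (real N * t)\<bar> \<le> e"
    by (simp add: mult.assoc)
qed

lemma averaging_prod:
  fixes n :: nat
  assumes "\<And>j. averaging (c j) (r j)"
  shows "averaging (\<lambda>N. \<Prod>j<n. c j N) (\<Sum>j<n. r j)"
proof (induction n)
  case 0
  show ?case by (simp add: averaging_one)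
next
  case (Suc n)
  show ?case using averaging_mult[OF Suc assms[of n]] by simp
qed

text \<open>Tannery's theorem with majorant \<open>\<bar>h N\<bar>\<close>, available because the
  bound 1 on the multipliers is part of \<open>averaging\<close>.\<close>

lemma averaging_limit:
  assumes c: "\<And>n. averaging (c n) r" and lim: "\<And>N. (\<lambda>n. c n N) \<longlonglongrightarrow> d N"
  shows "averaging d r"
  unfolding averaging_def
proof (intro conjI allI impI)
  show "\<bar>d N\<bar> \<le> 1" for N
    by (rule LIMSEQ_le_const2[OF tendsto_rabs[OF lim]]) (use averaging_le_1[OF c] in auto)
next
  fix h :: "nat \<Rightarrow> real" and t e :: real
  assume h: "summable (\<lambda>N. \<bar>h N\<bar>)"
    and le: "\<forall>s. \<bar>s\<bar> \<le> r \<longrightarrow> \<bar>\<Sum>N. h N * cos (real N * (t + s))\<bar> \<le> e"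
  have "(\<lambda>n. \<Sum>N. c n N * h N * cos (real N * t)) \<longlonglongrightarrow> (\<Sum>N. d N * h N * cos (real N * t))"
  proof (rule tannerys_theorem[THEN conjunct2, THEN conjunct2])
    show "summable (\<lambda>N. \<bar>h N\<bar>)" by fact
    have "\<bar>c n N * h N * cos (real N * t)\<bar> \<le> 1 * \<bar>h N\<bar> * 1" for n N
      unfolding abs_mult using averaging_le_1[OF c] by (intro mult_mono) auto
    then show "\<forall>\<^sub>F (N, n) in sequentially \<times>\<^sub>F sequentially. norm (c n N * h N * cos (real N * t)) \<le> \<bar>h N\<bar>"
      by (intro always_eventually) auto
  qed (auto intro!: tendsto_intros lim)
  then show "\<bar>\<Sum>N. d N * h N * cos (real N * t)\<bar> \<le> e"
    by (rule LIMSEQ_le_const2[OF tendsto_rabs]) (use averagingD[OF c h] le in blast)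
qed

section \<open>Uniform averages, the Poisson kernel and the bump function\<close>

definition sinc :: "real \<Rightarrow> real" where
  "sinc x = (if x = 0 then 1 else sin x / x)"

lemma abs_sinc_le_1: "\<bar>sinc x\<bar> \<le> 1"
  using abs_sin_x_le_abs_x[of x] by (simp add: sinc_def)

lemma abs_sinc_le_inverse: "x > 0 \<Longrightarrow> \<bar>sinc x\<bar> \<le> 1 / x"
  by (simp add: sinc_def divide_right_mono)

text \<open>Viete's product: n applications of the double-angle formula turn sin x into 2^n sin(x /
  2^n) times the cosines, and that prefactor tends to x.\<close>

lemma sinc_limit: "(\<lambda>n. \<Prod>i<n. cos (x / 2 ^ Suc i)) \<longlonglongrightarrow> sinc x"
proof (cases "x = 0")
  case False
  have eq: "(\<Prod>i<n. cos (x / 2 ^ Suc i)) * (2 ^ n * sin (x / 2 ^ n)) = sin x" for n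
  proof (induction n)
    case (Suc n)
    have "sin (x / 2 ^ n) = 2 * sin (x / 2 ^ Suc n) * cos (x / 2 ^ Suc n)"
      using sin_double[of "x / 2 ^ Suc n"] by simp
    with Suc show ?case by (simp add: mult_ac)
  qed simp
  have lim: "(\<lambda>n. 2 ^ n * sin (x / 2 ^ n)) \<longlonglongrightarrow> x"
    by real_asymp
  then have "(\<lambda>n. sin x / (2 ^ n * sin (x / 2 ^ n))) \<longlonglongrightarrow> sin x / x"
    using False by (intro tendsto_intros)
  moreover have "\<forall>\<^sub>F n in sequentially. sin x / (2 ^ n * sin (x / 2 ^ n)) = (\<Prod>i<n. cos (x / 2 ^ Suc i))"
    using tendsto_imp_eventually_ne[OF lim False]
  proof eventually_elim
    case (elim n)
    then show ?case using eq[of n] by (metis nonzero_mult_div_cancel_right)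
  qed
  ultimately show ?thesis
    using False by (simp add: sinc_def Lim_transform_eventually)
qed (simp add: sinc_def)

text \<open>The uniform mean over [-a, a], obtained without integration: it is the limit of
  two-point averages with steps a/2, a/4, ..., whose widths add up to at most
  \<open>a\<close>.\<close>

lemma averaging_sinc:
  assumes "a \<ge> 0"
  shows "averaging (\<lambda>N. sinc (a * real N)) a"
proof (rule averaging_limit)
  fix n
  have "(\<Sum>i<n. \<bar>a / 2 ^ Suc i\<bar>) = a * (1 - 1 / 2 ^ n)"
    using assms by (induction n) (simp_all add: field_simps)
  also have "\<dots> \<le> a"
    using assms by (simp add: mult_left_le)
  finally show "averaging (\<lambda>N. \<Prod>i<n. cos (a / 2 ^ Suc i * real N)) a"
    by (rule averaging_mono[OF averaging_prod[OF averaging_cos]])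
  show "(\<lambda>n. \<Prod>i<n. cos (a / 2 ^ Suc i * real N)) \<longlonglongrightarrow> sinc (a * real N)" for N
    using sinc_limit[of "a * real N"] by simp
qed

text \<open>The real part of the geometric series at r e^(it), minus 1/2. With the constant term
  halved this is half the usual two-sided kernel.\<close>

lemma poisson_kernel:
  assumes "0 < r" "r < 1"
  shows "(\<Sum>N. (if N = 0 then 1 / 2 else r ^ N) * cos (real N * t))
    = (1 - r\<^sup>2) / (2 * (1 - 2 * r * cos t + r\<^sup>2))"
proof -
  let ?z = "of_real r * cis t"
  have "(\<lambda>N. ?z ^ N) sums (1 / (1 - ?z))"
    using assms by (intro geometric_sums) (simp add: norm_mult)
  then have "(\<lambda>N. Re (?z ^ N)) sums Re (1 / (1 - ?z))"
    by (rule sums_Re)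
  moreover have "Re (?z ^ N) = r ^ N * cos (real N * t)" for N
    by (simp add: power_mult_distrib Complex.DeMoivre flip: of_real_power)
  ultimately have "(\<lambda>N. r ^ N * cos (real N * t) - (if N = 0 then 1 / 2 else 0)) sums (Re (1 / (1 - ?z)) - 1 / 2)"
    using sums_If_finite[of "\<lambda>N. N = 0" "\<lambda>_. 1 / 2 :: real"] by (intro sums_diff) (simp_all add: sums_def)
  also have "(\<lambda>N. r ^ N * cos (real N * t) - (if N = 0 then 1 / 2 else 0))
      = (\<lambda>N. (if N = 0 then 1 / 2 else r ^ N) * cos (real N * t))"
    by auto
  finally have "(\<Sum>N. (if N = 0 then 1 / 2 else r ^ N) * cos (real N * t)) = Re (1 / (1 - ?z)) - 1 / 2"
    by (simp add: sums_iff)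
  also have "\<dots> = (1 - r\<^sup>2) / (2 * (1 - 2 * r * cos t + r\<^sup>2))"
  proof -
    have den: "(1 - r * cos t)\<^sup>2 + (r * sin t)\<^sup>2 = 1 - 2 * r * cos t + r\<^sup>2"
      using sin_cos_squared_add[of t] by algebra
    have "r * cos t \<le> r" using assms by simp
    then have "(1 - r * cos t)\<^sup>2 > 0" using assms by (intro zero_less_power) linarith
    then have pos: "1 - 2 * r * cos t + r\<^sup>2 > 0"
      using den zero_le_power2[of "r * sin t"] by linarith
    have "Re (1 / (1 - ?z)) = (1 - r * cos t) / (1 - 2 * r * cos t + r\<^sup>2)"
      by (simp add: Re_divide den)
    then show ?thesis
      using pos by (simp add: field_simps)
  qed
  finally show ?thesis .
qed

text \<open>Apply the averaging to the Poisson kernel and let it concentrate at \<open>1\<close>.\<close>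
lemma averaging_vanishes:
  assumes c: "averaging c r" and sc: "summable (\<lambda>N. \<bar>c N\<bar>)" and t: "cmod (cis t - 1) > r"
  shows "(\<Sum>N. (if N = 0 then c 0 / 2 else c N) * cos (real N * t)) = 0"
proof -
  \<comment> \<open>The squared distance from 1 that \<open>cis (t + s)\<close> keeps for every
    admissible shift \<open>s\<close>. It bounds the denominator of the Poisson kernel from below,
    while the numerator tends to 0.\<close>
  define \<eta> where "\<eta> = (cmod (cis t - 1) - r)\<^sup>2"
  have \<eta>: "\<eta> > 0" using t by (simp add: \<eta>_def)
  define \<rho> where "\<rho> n = 1 - 1 / (real n + 2)" for n
  have \<rho>: "0 < \<rho> n" "\<rho> n < 1" for n by (simp_all add: \<rho>_def field_simps)
  define h where "h n N = (if N = 0 then 1 / 2 else \<rho> n ^ N)" for n N :: nat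
  have habs: "\<bar>h n N\<bar> \<le> 1" for n N
    using \<rho>[of n] by (simp add: h_def power_le_one)
  have le: "\<bar>\<Sum>N. c N * h n N * cos (real N * t)\<bar> \<le> (1 - (\<rho> n)\<^sup>2) / (2 * (\<rho> n * \<eta>))" for n
  proof (rule averagingD[OF c])
    have "summable (\<lambda>N. \<rho> n ^ N)" using \<rho>[of n] by (simp add: summable_geometric)
    then show "summable (\<lambda>N. \<bar>h n N\<bar>)"
      by (rule summable_comparison_test'[where N = 0]) (use \<rho>[of n] in \<open>auto simp: h_def\<close>)
    fix s assume s: "\<bar>s\<bar> \<le> r"
    have "cmod (cis (t + s) - cis t) \<le> \<bar>s\<bar>"
    proof -
      have "cis (t + s) - cis t = cis t * (cis s - 1)"
        by (simp add: cis_mult[symmetric] algebra_simps)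
      then have "cmod (cis (t + s) - cis t) = cmod (cis s - 1)"
        by (simp add: norm_mult)
      also have "\<dots> \<le> \<bar>s\<bar>"
        using dist_exp_i_1[of s] abs_sin_x_le_abs_x[of "s / 2"] by (simp add: cis_conv_exp)
      finally show ?thesis .
    qed
    then have "cmod (cis t - 1) - r \<le> cmod (cis (t + s) - 1)"
      using s norm_triangle_ineq[of "cis t - cis (t + s)" "cis (t + s) - 1"]
      by (simp add: norm_minus_commute)
    then have "\<eta> \<le> (cmod (cis (t + s) - 1))\<^sup>2"
      unfolding \<eta>_def using t by (intro power_mono) auto
    also have "\<dots> = (cos (t + s) - 1)\<^sup>2 + (sin (t + s))\<^sup>2"
      by (simp add: cmod_power2)
    also have "\<dots> = 2 - 2 * cos (t + s)"
      using sin_cos_squared_add[of "t + s"] by algebra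
    finally have "\<rho> n * \<eta> \<le> \<rho> n * (2 - 2 * cos (t + s))"
      using \<rho>[of n] by (intro mult_left_mono) auto
    also have "\<dots> \<le> (1 - \<rho> n)\<^sup>2 + \<rho> n * (2 - 2 * cos (t + s))" by simp
    also have "\<dots> = 1 - 2 * \<rho> n * cos (t + s) + (\<rho> n)\<^sup>2"
      by (simp add: power2_eq_square algebra_simps)
    finally have den: "\<rho> n * \<eta> \<le> 1 - 2 * \<rho> n * cos (t + s) + (\<rho> n)\<^sup>2" .
    have "(\<rho> n)\<^sup>2 \<le> 1" using \<rho>[of n] by (simp add: power_le_one)
    moreover have "\<rho> n * \<eta> > 0" using \<rho>[of n] \<eta> by simp
    ultimately show "\<bar>\<Sum>N. h n N * cos (real N * (t + s))\<bar> \<le> (1 - (\<rho> n)\<^sup>2) / (2 * (\<rho> n * \<eta>))"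
      unfolding h_def poisson_kernel[OF \<rho>] using den by (auto intro!: divide_left_mono)
  qed
  have "(\<lambda>n. \<Sum>N. c N * h n N * cos (real N * t))
      \<longlonglongrightarrow> (\<Sum>N. (if N = 0 then c 0 / 2 else c N) * cos (real N * t))"
  proof (rule tannerys_theorem[THEN conjunct2, THEN conjunct2])
    have "\<bar>c N * h n N * cos (real N * t)\<bar> \<le> \<bar>c N\<bar> * 1 * 1" for n N
      unfolding abs_mult using habs by (intro mult_mono) auto
    then show "\<forall>\<^sub>F (N, n) in sequentially \<times>\<^sub>F sequentially. norm (c N * h n N * cos (real N * t)) \<le> \<bar>c N\<bar>"
      by (intro always_eventually) auto
    have "\<rho> \<longlonglongrightarrow> 1" unfolding \<rho>_def by real_asymp
    then have "(\<lambda>n. \<rho> n ^ N) \<longlonglongrightarrow> 1 ^ N" for N by (intro tendsto_power)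
    then have lim: "(\<lambda>n. c N * \<rho> n ^ N * cos (real N * t)) \<longlonglongrightarrow> c N * 1 ^ N * cos (real N * t)" for N
      by (intro tendsto_mult tendsto_const)
    show "(\<lambda>n. c N * h n N * cos (real N * t)) \<longlonglongrightarrow> (if N = 0 then c 0 / 2 else c N) * cos (real N * t)" for N
      by (cases "N = 0") (use lim[of N] in \<open>simp_all add: h_def\<close>)
  qed (use sc in auto)
  moreover have "(\<lambda>n. \<Sum>N. c N * h n N * cos (real N * t)) \<longlonglongrightarrow> 0"
  proof (rule Lim_null_comparison)
    show "\<forall>\<^sub>F n in sequentially. norm (\<Sum>N. c N * h n N * cos (real N * t)) \<le> (1 - (\<rho> n)\<^sup>2) / (2 * (\<rho> n * \<eta>))"
      using le by simp
    show "(\<lambda>n. (1 - (\<rho> n)\<^sup>2) / (2 * (\<rho> n * \<eta>))) \<longlonglongrightarrow> 0"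
      unfolding \<rho>_def using \<eta> by real_asymp
  qed
  ultimately show ?thesis using LIMSEQ_unique by blast
qed

lemma summable_exp_powr:
  fixes K \<kappa> :: real
  assumes "0 < \<gamma>" "\<gamma> < g" "\<kappa> > 0"
  shows "summable (\<lambda>N. exp (K * real N powr \<gamma> - \<kappa> * real N powr g))"
proof (rule summable_comparison_test_bigo)
  show "summable (\<lambda>N. norm (1 / real N ^ 2))"
    using inverse_power_summable[of 2, where 'a = real] by (simp add: field_simps)
  show "(\<lambda>N. exp (K * real N powr \<gamma> - \<kappa> * real N powr g)) \<in> O(\<lambda>N. 1 / real N ^ 2)"
    using assms by real_asymp
qed

text \<open>An infinite convolution of uniform averages of widths proportional to (j + 1)^(-1/g).
  Since 1/g > 1 the widths are summable, which gives small support. At frequency N about N^g of the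
  factors are at most 1/e, which gives the decay.\<close>

lemma exists_rapidly_decaying_bump:
  assumes g: "0 < g" "g < 1" and r: "r > 0"
  shows "\<exists>c K \<kappa>. \<kappa> > 0 \<and> (\<forall>N. \<bar>c N\<bar> \<le> K * exp (- \<kappa> * real N powr g))
    \<and> (\<forall>t. cmod (cis t - 1) > r \<longrightarrow> (\<Sum>N. c N * cos (real N * t)) = 0)
    \<and> (\<exists>t. (\<Sum>N. c N * cos (real N * t)) \<noteq> 0)"
proof -
  define S where "S = (\<Sum>j. (real j + 1) powr (- 1 / g))"
  have "summable (\<lambda>j. real j powr (- 1 / g))"
    using g by (simp add: summable_real_powr_iff field_simps)
  then have sS: "summable (\<lambda>j. (real j + 1) powr (- 1 / g))"
    using summable_Suc_iff[of "\<lambda>j. real j powr (- 1 / g)"] by (simp add: add.commute)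
  have S: "S > 0"
    unfolding S_def using sS by (intro suminf_pos) auto
  \<comment> \<open>Every factor occurs twice, so the total width is \<open>2 * a * S\<close>, that
    is, \<open>r\<close>.\<close>
  define a where "a = r / (2 * S)"
  have a: "a > 0" using r S by (simp add: a_def)
  define \<alpha> where "\<alpha> j = a * (real j + 1) powr (- 1 / g)" for j
  have \<alpha>: "\<alpha> j > 0" for j using a by (simp add: \<alpha>_def)
  \<comment> \<open>Squaring puts the factors between 0 and 1, so the partial products decrease to a
    limit that lies below each of them.\<close>
  define \<pi> where "\<pi> n N = (\<Prod>j<n. sinc (\<alpha> j * real N) * sinc (\<alpha> j * real N))" for n N :: nat
  have fac: "0 \<le> sinc x * sinc x" "sinc x * sinc x \<le> 1" for x
    using abs_sinc_le_1[of x] mult_le_one[of "\<bar>sinc x\<bar>" "\<bar>sinc x\<bar>"] by auto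
  have \<pi>0: "0 \<le> \<pi> n N" for n N unfolding \<pi>_def by (intro prod_nonneg) (use fac in auto)
  have dec: "decseq (\<lambda>n. \<pi> n N)" for N
    unfolding decseq_Suc_iff using \<pi>0[of _ N] fac by (auto simp: \<pi>_def mult_left_le)
  have "\<exists>l. (\<lambda>n. \<pi> n N) \<longlonglongrightarrow> l" for N
    using decseq_convergent[OF dec, of 0] \<pi>0 by metis
  then obtain c where c: "\<And>N. (\<lambda>n. \<pi> n N) \<longlonglongrightarrow> c N" by metis
  have c_le: "c N \<le> \<pi> n N" for n N
    using decseq_ge[OF dec c] .
  have c_ge: "0 \<le> c N" for N
    by (rule LIMSEQ_le_const[OF c]) (use \<pi>0 in auto)
  have avg: "averaging c r"
  proof (rule averaging_limit[OF _ c])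
    fix n
    have "(\<Sum>j<n. \<alpha> j + \<alpha> j) = 2 * a * (\<Sum>j<n. (real j + 1) powr (- 1 / g))"
      by (simp add: \<alpha>_def sum_distrib_left mult.assoc)
    also have "\<dots> \<le> 2 * a * S"
      unfolding S_def using a by (intro mult_left_mono sum_le_suminf sS) auto
    also have "\<dots> = r" using S by (simp add: a_def)
    finally have sum: "(\<Sum>j<n. \<alpha> j + \<alpha> j) \<le> r" .
    have "averaging (\<lambda>N. \<Prod>j<n. sinc (\<alpha> j * real N) * sinc (\<alpha> j * real N)) (\<Sum>j<n. \<alpha> j + \<alpha> j)"
      using \<alpha> by (intro averaging_prod averaging_mult averaging_sinc) (auto intro: less_imp_le)
    then show "averaging (\<pi> n) r"
      unfolding \<pi>_def using sum by (rule averaging_mono)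
  qed
  have "c 0 = 1"
    using LIMSEQ_unique[OF c[of 0], of 1] by (simp add: \<pi>_def sinc_def)
  \<comment> \<open>Solving \<open>\<alpha> j * real N \<ge> exp 1\<close> for \<open>j\<close>
    gives j + 1 \<le> \<kappa> N^g. Rounding this count down costs the factor \<open>exp 1\<close>
    in \<open>decay\<close>.\<close>
  define \<kappa> where "\<kappa> = (a / exp 1) powr g"
  have \<kappa>: "\<kappa> > 0" using a by (simp add: \<kappa>_def)
  have decay: "c N \<le> exp 1 * exp (- \<kappa> * real N powr g)" for N
  proof -
    define J where "J = nat \<lfloor>\<kappa> * real N powr g\<rfloor>"
    have J: "real J \<le> \<kappa> * real N powr g" "\<kappa> * real N powr g < real J + 1"
      using \<kappa> by (auto simp: J_def)
    have "c N \<le> \<pi> J N" by (rule c_le)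
    also have "\<dots> \<le> (\<Prod>j<J. exp (- 1))"
      unfolding \<pi>_def
    proof (intro prod_mono conjI fac)
      fix j assume j: "j \<in> {..<J}"
      then have "real j + 1 \<le> \<kappa> * real N powr g" using J(1) by (simp add: nat_less_real_le)
      also have "\<dots> = (a * real N / exp 1) powr g"
        using a by (simp add: \<kappa>_def powr_mult powr_divide)
      finally have "(real j + 1) powr (1 / g) \<le> ((a * real N / exp 1) powr g) powr (1 / g)"
        using g by (intro powr_mono2) auto
      also have "\<dots> = a * real N / exp 1"
        using a g by (simp add: powr_powr)
      finally have "exp 1 \<le> a * real N / (real j + 1) powr (1 / g)"
        by (simp add: field_simps)
      also have "\<dots> = \<alpha> j * real N"
        by (simp add: \<alpha>_def powr_minus_divide)
      finally have e: "exp 1 \<le> \<alpha> j * real N" .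
      then have pos: "0 < \<alpha> j * real N" by (meson exp_gt_zero less_le_trans)
      have "\<bar>sinc (\<alpha> j * real N)\<bar> \<le> 1 / (\<alpha> j * real N)"
        by (rule abs_sinc_le_inverse[OF pos])
      also have "\<dots> \<le> 1 / exp 1" using e pos by (intro divide_left_mono) auto
      finally have "\<bar>sinc (\<alpha> j * real N)\<bar> \<le> exp (- 1)" by (simp add: exp_minus field_simps)
      then have "\<bar>sinc (\<alpha> j * real N)\<bar> * \<bar>sinc (\<alpha> j * real N)\<bar> \<le> exp (- 1) * 1"
        using abs_sinc_le_1 by (intro mult_mono) auto
      then show "sinc (\<alpha> j * real N) * sinc (\<alpha> j * real N) \<le> exp (- 1)"
        by (simp add: abs_mult[symmetric])
    qed
    also have "\<dots> = exp (- real J)"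
      by (simp flip: exp_of_nat_mult)
    also have "\<dots> \<le> exp (1 - \<kappa> * real N powr g)" using J by simp
    finally show ?thesis by (simp add: exp_diff exp_minus field_simps)
  qed
  have sc: "summable (\<lambda>N. \<bar>c N\<bar>)"
  proof (rule summable_comparison_test'[where N = 0])
    show "summable (\<lambda>N. exp 1 * exp (- \<kappa> * real N powr g))"
      using summable_exp_powr[of "g / 2" g \<kappa> 0] g \<kappa> by (simp add: summable_mult)
    show "norm \<bar>c N\<bar> \<le> exp 1 * exp (- \<kappa> * real N powr g)" for N
      using decay[of N] c_ge[of N] by simp
  qed
  \<comment> \<open>The halved constant term is the one for which \<open>averaging_vanishes\<close>
    gives zero.\<close>
  define d where "d N = (if N = 0 then c 0 / 2 else c N)" for N
  have "\<bar>d N\<bar> \<le> \<bar>c N\<bar>" for N using c_ge[of 0] by (simp add: d_def)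
  have "\<bar>d N\<bar> \<le> exp 1 * exp (- \<kappa> * real N powr g)" for N
    using decay[of N] c_ge[of N] \<open>\<bar>d N\<bar> \<le> \<bar>c N\<bar>\<close> by linarith
  moreover have "(\<Sum>N. d N * cos (real N * t)) = 0" if "cmod (cis t - 1) > r" for t
    using averaging_vanishes[OF avg sc that] by (simp add: d_def)
  moreover have "\<exists>t. (\<Sum>N. d N * cos (real N * t)) \<noteq> 0"
  proof (rule ccontr)
    assume "\<not> ?thesis"
    then have zero: "(\<Sum>N. d N * cos (real N * t)) = 0" for t by blast
    have "summable (\<lambda>N. \<bar>d N\<bar>)"
      by (rule summable_comparison_test'[OF sc, of 0]) (use \<open>\<And>N. \<bar>d N\<bar> \<le> \<bar>c N\<bar>\<close> in auto)
    \<comment> \<open>averaging with half-width \<open>\<pi>\<close> is integration over the circle and extracts \<open>d 0\<close>\<close>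
    then have "\<bar>\<Sum>N. sinc (pi * real N) * d N * cos (real N * 0)\<bar> \<le> 0"
      by (rule averagingD[OF averaging_sinc[OF pi_ge_zero]]) (simp_all add: zero)
    moreover have "(\<lambda>N. sinc (pi * real N) * d N * cos (real N * 0)) = (\<lambda>N. if N = 0 then d 0 else 0)"
      by (auto simp: sinc_def)
    moreover have "(\<Sum>N. if N = 0 then d 0 else 0) = d (0::nat)"
      using suminf_finite[of "{0::nat}" "\<lambda>N. if N = 0 then d 0 else 0"] by simp
    ultimately show False using \<open>c 0 = 1\<close> by (simp add: d_def)
  qed
  ultimately show ?thesis using \<kappa> by blast
qed

section \<open>Banach star-subalgebras\<close>

text \<open>Strong induction on N after splitting off the remainder modulo \<open>k\<close>. The
  first alternative costs a factor \<open>P\<close> and the second a factor (k - 1)^\<gamma>; both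
  are smaller than the k^\<gamma> that the claimed bound gains from m to km.\<close>

lemma subadditive_growth:
  fixes L :: "nat \<Rightarrow> real" and P c :: real and k :: nat
  assumes k: "k \<ge> 2" and P: "P \<ge> 1" "P < real k" and c: "c \<ge> 0" and L0: "\<And>N. L N \<ge> 0"
    and sub: "\<And>M N. L (M + N) \<le> L M + L N"
    and rec: "\<And>m. m \<ge> 1 \<Longrightarrow> L (k * m) \<le> c + P * L m \<or> (\<exists>j. 1 \<le> j \<and> j < k \<and> L (k * m) \<le> c + L (j * m))"
  shows "\<exists>K \<gamma>. 0 < \<gamma> \<and> \<gamma> < 1 \<and> (\<forall>N\<ge>1. L N \<le> K * real N powr \<gamma>)"
proof -
  \<comment> \<open>Makes k^\<gamma> the midpoint of \<open>P\<close> and \<open>k\<close>: above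
    \<open>P\<close>, and below \<open>k\<close> so that \<gamma> < 1.\<close>
  define \<gamma> where "\<gamma> = log (real k) ((P + real k) / 2)"
  have \<gamma>: "0 < \<gamma>" "\<gamma> < 1"
    using k P by (auto simp: \<gamma>_def log_less_one_cancel_iff)
  have k\<gamma>: "real k powr \<gamma> = (P + real k) / 2"
    using k P by (simp add: \<gamma>_def)
  \<comment> \<open>The gain left over after the worse alternative. A large \<open>K\<close> makes
    it pay for the constant \<open>c'\<close>, which includes the cost of the remainder.\<close>
  define \<delta> where "\<delta> = real k powr \<gamma> - max P ((real k - 1) powr \<gamma>)"
  have "(real k - 1) powr \<gamma> < real k powr \<gamma>"
    using k \<gamma> by (intro powr_less_mono2) auto
  then have \<delta>: "\<delta> > 0" using P by (simp add: \<delta>_def k\<gamma>)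
  define c' where "c' = c + real k * L 1"
  define K where "K = max (c' / \<delta>) (real k * L 1)"
  have K0: "K \<ge> 0" using L0[of 1] by (simp add: K_def le_max_iff_disj)
  have lin: "L N \<le> real N * L 1" if "N \<ge> 1" for N
    using that
  proof (induction N rule: nat_induct_at_least)
    case (Suc N)
    then show ?case using sub[of N 1] by (simp add: algebra_simps)
  qed simp
  have "L N \<le> K * real N powr \<gamma>" if "N \<ge> 1" for N
    using that
  proof (induction N rule: less_induct)
    case (less N)
    show ?case
    proof (cases "N < k")
      case True
      then have "real N * L 1 \<le> real k * L 1"
        using L0[of 1] by (intro mult_right_mono) auto
      then have "L N \<le> K * 1"
        using lin[OF less.prems] by (simp add: K_def)
      also have "\<dots> \<le> K * real N powr \<gamma>"
        using less.prems \<gamma> K0 by (intro mult_left_mono ge_one_powr_ge_zero) auto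
      finally show ?thesis .
    next
      case False
      define m where "m = N div k"
      have m: "m \<ge> 1" using False k by (simp add: m_def div_greater_zero_iff Suc_le_eq)
      have Nm: "N = k * m + N mod k" by (simp add: m_def)
      have mk: "m < k * m" "k * m \<le> N" using m k Nm by auto
      have "L N \<le> L (k * m) + real k * L 1"
      proof (cases "N mod k = 0")
        case True
        then show ?thesis using Nm L0[of 1] by (metis add.right_neutral le_add_same_cancel1 mult_nonneg_nonneg of_nat_0_le_iff)
      next
        case False
        have "real (N mod k) * L 1 \<le> real k * L 1"
          using L0[of 1] k by (intro mult_right_mono) auto
        then show ?thesis
          using sub[of "k * m" "N mod k"] lin[of "N mod k"] False Nm by simp
      qed
      moreover have "L (k * m) \<le> c + K * (max P ((real k - 1) powr \<gamma>) * real m powr \<gamma>)"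
        using rec[OF m]
      proof (elim disjE exE conjE)
        assume "L (k * m) \<le> c + P * L m"
        moreover have "P * L m \<le> P * (K * real m powr \<gamma>)"
          using less.IH[of m] m mk P by (intro mult_left_mono) auto
        moreover have "\<dots> = K * (P * real m powr \<gamma>)" by simp
        moreover have "\<dots> \<le> K * (max P ((real k - 1) powr \<gamma>) * real m powr \<gamma>)"
          using K0 by (intro mult_left_mono mult_right_mono) auto
        ultimately show ?thesis by linarith
      next
        fix j assume j: "1 \<le> j" "j < k" "L (k * m) \<le> c + L (j * m)"
        have "j * m < N" using j(2) m mk by (metis less_le_trans mult_less_mono1 less_eq_Suc_le One_nat_def)
        then have "L (j * m) \<le> K * real (j * m) powr \<gamma>"
          using j m by (intro less.IH) auto
        also have "\<dots> \<le> K * ((real k - 1) * real m) powr \<gamma>"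
          using j k K0 \<gamma> by (intro mult_left_mono powr_mono2) (auto intro!: mult_right_mono)
        also have "\<dots> = K * ((real k - 1) powr \<gamma> * real m powr \<gamma>)"
          using k by (simp add: powr_mult)
        also have "\<dots> \<le> K * (max P ((real k - 1) powr \<gamma>) * real m powr \<gamma>)"
          using K0 by (intro mult_left_mono mult_right_mono) auto
        finally show ?thesis using j by linarith
      qed
      moreover have "c' \<le> K * \<delta> * real m powr \<gamma>"
      proof -
        have "c' / \<delta> \<le> K" by (simp add: K_def)
        then have "c' \<le> K * \<delta> * 1" using \<delta> by (simp add: divide_le_eq)
        also have "\<dots> \<le> K * \<delta> * real m powr \<gamma>"
          using m \<gamma> K0 \<delta> by (intro mult_left_mono ge_one_powr_ge_zero) auto
        finally show ?thesis .
      qed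
      ultimately have "L N \<le> K * real k powr \<gamma> * real m powr \<gamma>"
        by (simp add: c'_def \<delta>_def algebra_simps)
      also have "\<dots> = K * real (k * m) powr \<gamma>" by (simp add: powr_mult)
      also have "\<dots> \<le> K * real N powr \<gamma>"
        using mk K0 \<gamma> by (intro mult_left_mono powr_mono2) (auto simp flip: of_nat_mult)
      finally show ?thesis .
    qed
  qed
  then show ?thesis using \<gamma> by blast
qed

text \<open>Only the leading coefficient matters, and that the coefficients do not depend on
  \<open>V\<close>. At V = 1 they sum to 0, so each power may be replaced by itself minus 1, an
  expression that survives without a unit.\<close>

lemma power_minus_one_expansion:
  assumes "k \<ge> 1"
  shows "\<exists>e :: nat \<Rightarrow> real. e k = 1
    \<and> (\<forall>V :: 'a::real_algebra_1. (V - 1) ^ k = (\<Sum>j=1..k. e j *\<^sub>R (V ^ j - 1)))"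
proof -
  have "\<exists>e :: nat \<Rightarrow> real. e k = 1 \<and> (\<forall>j>k. e j = 0)
      \<and> (\<forall>V :: 'a. (V - 1) ^ k = (\<Sum>j\<le>k. e j *\<^sub>R V ^ j))" for k
  proof (induction k)
    case 0
    show ?case by (intro exI[of _ "\<lambda>j. if j = 0 then 1 else 0"]) auto
  next
    case (Suc k)
    then obtain e :: "nat \<Rightarrow> real" where e: "e k = 1" "\<And>j. j > k \<Longrightarrow> e j = 0"
      "\<And>V :: 'a. (V - 1) ^ k = (\<Sum>j\<le>k. e j *\<^sub>R V ^ j)" by blast
    \<comment> \<open>Multiplication by \<open>V - 1\<close>: the shifted coefficients minus the old
      ones.\<close>
    define e' where "e' j = (case j of 0 \<Rightarrow> 0 | Suc i \<Rightarrow> e i) - e j" for j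
    have "(V - 1) ^ Suc k = (\<Sum>j\<le>Suc k. e' j *\<^sub>R V ^ j)" for V :: 'a
    proof -
      have "(\<Sum>j\<le>Suc k. e' j *\<^sub>R V ^ j)
          = (\<Sum>j\<le>Suc k. (case j of 0 \<Rightarrow> 0 | Suc i \<Rightarrow> e i) *\<^sub>R V ^ j) - (\<Sum>j\<le>Suc k. e j *\<^sub>R V ^ j)"
        by (simp add: e'_def scaleR_diff_left sum_subtractf del: sum.atMost_Suc)
      also have "(\<Sum>j\<le>Suc k. (case j of 0 \<Rightarrow> 0 | Suc i \<Rightarrow> e i) *\<^sub>R V ^ j) = V * (\<Sum>j\<le>k. e j *\<^sub>R V ^ j)"
        by (subst sum.atMost_Suc_shift) (simp add: sum_distrib_left)
      also have "(\<Sum>j\<le>Suc k. e j *\<^sub>R V ^ j) = (\<Sum>j\<le>k. e j *\<^sub>R V ^ j)"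
        by (simp add: e(2))
      finally show ?thesis by (simp add: e(3)[symmetric] left_diff_distrib)
    qed
    moreover have "e' (Suc k) = 1" "\<forall>j>Suc k. e' j = 0"
      using e by (auto simp: e'_def split: nat.split)
    ultimately show ?case by blast
  qed
  then obtain e :: "nat \<Rightarrow> real" where e: "e k = 1"
    "\<And>V :: 'a. (V - 1) ^ k = (\<Sum>j\<le>k. e j *\<^sub>R V ^ j)" by blast
  have "(\<Sum>j\<le>k. e j *\<^sub>R 1) = (0 :: 'a)"
    using e(2)[of 1] assms by (simp add: power_0_left)
  then have "(V - 1) ^ k = (\<Sum>j\<le>k. e j *\<^sub>R (V ^ j - 1))" for V :: 'a
    by (simp add: e(2) scaleR_diff_right sum_subtractf)
  also have "(\<Sum>j\<le>k. e j *\<^sub>R (V ^ j - 1)) = (\<Sum>j=1..k. e j *\<^sub>R (V ^ j - 1))" for V :: 'a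
    by (rule sum.mono_neutral_right) (auto simp: not_less_eq_eq)
  finally show ?thesis using e(1) by blast
qed

section \<open>Closed subalgebras and comparison of the two norms\<close>

locale banach_star_sub =
  fixes A :: "'b::cstar_algebra set" and n :: "'b \<Rightarrow> real"
  assumes banach: "banach_star_subalgebra A n"
begin

lemma A_subalgebra: "subalgebra A"
  using banach by (simp add: banach_star_subalgebra_def star_subalgebra_def)

lemma A_invol: "x \<in> A \<Longrightarrow> invol x \<in> A"
  using banach by (simp add: banach_star_subalgebra_def star_subalgebra_def)

lemma n_nonneg: "x \<in> A \<Longrightarrow> 0 \<le> n x"
  and n_eq_0: "x \<in> A \<Longrightarrow> n x = 0 \<longleftrightarrow> x = 0"
  and n_add: "x \<in> A \<Longrightarrow> y \<in> A \<Longrightarrow> n (x + y) \<le> n x + n y"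
  and n_mult: "x \<in> A \<Longrightarrow> y \<in> A \<Longrightarrow> n (x * y) \<le> n x * n y"
  and n_cscale: "x \<in> A \<Longrightarrow> n (cscale c x) = cmod c * n x"
  using banach by (auto simp: banach_star_subalgebra_def algebra_norm_on_def)

lemma n_complete:
  assumes "\<And>i. X i \<in> A" "\<And>e. e > 0 \<Longrightarrow> \<exists>N. \<forall>i\<ge>N. \<forall>j\<ge>N. n (X i - X j) < e"
  shows "\<exists>y\<in>A. (\<lambda>i. n (X i - y)) \<longlonglongrightarrow> 0"
proof -
  have "\<forall>X. (\<forall>i. X i \<in> A) \<and> (\<forall>e>0. \<exists>N. \<forall>i\<ge>N. \<forall>j\<ge>N. n (X i - X j) < e)
      \<longrightarrow> (\<exists>y\<in>A. (\<lambda>i. n (X i - y)) \<longlonglongrightarrow> 0)"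
    using banach unfolding banach_star_subalgebra_def by (elim conjE)
  from this[rule_format, of X] assms show ?thesis by simp
qed

end

lemma
  assumes "subalgebra S"
  shows subalgebra_zero: "0 \<in> S"
    and subalgebra_add: "x \<in> S \<Longrightarrow> y \<in> S \<Longrightarrow> x + y \<in> S"
    and subalgebra_mult: "x \<in> S \<Longrightarrow> y \<in> S \<Longrightarrow> x * y \<in> S"
    and subalgebra_cscale: "x \<in> S \<Longrightarrow> cscale c x \<in> S"
  using assms by (auto simp: subalgebra_def)

lemma subalgebra_minus: "subalgebra S \<Longrightarrow> x \<in> S \<Longrightarrow> - x \<in> S"
  using subalgebra_cscale[of S x "- 1"] by (simp add: cscale_one)

lemma subalgebra_diff: "subalgebra S \<Longrightarrow> x \<in> S \<Longrightarrow> y \<in> S \<Longrightarrow> x - y \<in> S"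
  using subalgebra_add[of S x "- y"] by (simp add: subalgebra_minus)

lemma subalgebra_sum: "subalgebra S \<Longrightarrow> (\<And>i. i \<in> I \<Longrightarrow> f i \<in> S) \<Longrightarrow> sum f I \<in> S"
  by (induction I rule: infinite_finite_induct) (auto simp: subalgebra_zero subalgebra_add)

lemma subalgebra_pow1: "subalgebra S \<Longrightarrow> x \<in> S \<Longrightarrow> pow1 x m \<in> S"
  by (induction m) (auto simp: subalgebra_mult)

lemmas subalgebra_closed = subalgebra_zero subalgebra_add subalgebra_mult subalgebra_cscale
  subalgebra_minus subalgebra_diff subalgebra_sum subalgebra_pow1

lemma pow1_Suc_right: "pow1 (x::'a::semigroup_mult) (Suc m) = pow1 x m * x"
proof (induction m)
  case (Suc m)
  then show ?case by (metis mult.assoc pow1.simps(2))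
qed simp

context banach_star_sub
begin

lemmas A_closed = subalgebra_closed[OF A_subalgebra] A_invol

definition closed_subalgebra :: "'b set \<Rightarrow> bool" where
  "closed_subalgebra S \<longleftrightarrow> S \<subseteq> A \<and> subalgebra S \<and> closed_in_norm A n S"

lemma closed_subalgebraD:
  assumes "closed_subalgebra S"
  shows "x \<in> S \<Longrightarrow> x \<in> A" "subalgebra S"
  using assms by (auto simp: closed_subalgebra_def)

lemma closed_subalgebra_limit:
  assumes "closed_subalgebra S" "\<And>i. X i \<in> S" "y \<in> A" "(\<lambda>i. n (X i - y)) \<longlonglongrightarrow> 0"
  shows "y \<in> S"
  using assms by (auto simp: closed_subalgebra_def closed_in_norm_def)

lemma closed_subalgebra_A: "closed_subalgebra A"
  by (simp add: closed_subalgebra_def closed_in_norm_def A_subalgebra)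

lemma n_minus: "x \<in> A \<Longrightarrow> n (- x) = n x"
  using n_cscale[of x "- 1"] by (simp add: cscale_one)

lemma n_diff_commute: "x \<in> A \<Longrightarrow> y \<in> A \<Longrightarrow> n (x - y) = n (y - x)"
  using n_minus[of "x - y"] by (simp add: A_closed)

lemma n_diff_triangle: "x \<in> A \<Longrightarrow> y \<in> A \<Longrightarrow> z \<in> A \<Longrightarrow> n (x - z) \<le> n (x - y) + n (y - z)"
  using n_add[of "x - y" "y - z"] by (simp add: A_closed)

lemma n_sum: "(\<And>i. i \<in> I \<Longrightarrow> f i \<in> A) \<Longrightarrow> n (sum f I) \<le> (\<Sum>i\<in>I. n (f i))"
proof (induction I rule: infinite_finite_induct)
  case (insert i I)
  then show ?case using n_add[of "f i" "sum f I"] by (simp add: A_closed)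
qed (use n_eq_0[OF A_closed(1)] in simp_all)

lemma n_pow1: "x \<in> A \<Longrightarrow> n (pow1 x m) \<le> n x ^ Suc m"
proof (induction m)
  case (Suc m)
  then show ?case
    using n_mult[of x "pow1 x m"] mult_left_mono[OF Suc.IH n_nonneg[of x]] by (simp add: A_closed)
qed simp

lemma absolutely_convergent_series:
  assumes S: "closed_subalgebra S" and f: "\<And>i. f i \<in> S" and sf: "summable (\<lambda>i. n (f i))"
  shows "\<exists>y\<in>S. (\<lambda>m. n ((\<Sum>i<m. f i) - y)) \<longlonglongrightarrow> 0"
proof -
  note S' = closed_subalgebraD[OF S]
  have fA: "f i \<in> A" for i using S'(1) f by blast
  let ?X = "\<lambda>m. \<Sum>i<m. f i"
  have XA: "?X m \<in> A" for m by (intro A_closed fA)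
  have le: "n (?X j - ?X i) \<le> (\<Sum>l=i..<j. n (f l))" if "i \<le> j" for i j
  proof -
    have "?X j - ?X i = (\<Sum>l=i..<j. f l)"
      using sum_diff_nat_ivl[of 0 i j f] that by (simp add: atLeast0LessThan)
    then show ?thesis using n_sum[of "{i..<j}" f] fA by simp
  qed
  have "\<exists>N. \<forall>i\<ge>N. \<forall>j\<ge>N. n (?X i - ?X j) < e" if "e > 0" for e
  proof -
    obtain N where N: "\<And>i j. i \<ge> N \<Longrightarrow> norm (\<Sum>l=i..<j. n (f l)) < e"
      using sf[unfolded summable_Cauchy] \<open>e > 0\<close> by metis
    have "n (?X j - ?X i) < e" if "i \<ge> N" "i \<le> j" for i j
      using le[OF that(2)] N[OF that(1), of j] by simp
    then show ?thesis
      by (metis XA n_diff_commute nle_le)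
  qed
  then obtain y where y: "y \<in> A" "(\<lambda>m. n (?X m - y)) \<longlonglongrightarrow> 0"
    using n_complete[of ?X] XA by blast
  moreover have "y \<in> S"
    by (rule closed_subalgebra_limit[OF S, of ?X, OF _ y]) (intro subalgebra_sum[OF S'(2)] f)
  ultimately show ?thesis by blast
qed

text \<open>The unit-free Neumann series y = x + x^2 + ...: the equations say that 1 + y is inverse
  to 1 - x. The limit stays in \<open>S\<close> because \<open>S\<close> is closed for
  \<open>n\<close>.\<close>

lemma quasi_inverse:
  assumes S: "closed_subalgebra S" and x: "x \<in> S" and nx: "n x < 1"
  shows "\<exists>y\<in>S. y = x + x * y \<and> y = x + y * x"
proof -
  note S' = closed_subalgebraD[OF S]
  have xA: "x \<in> A" using x S' by blast
  have "summable (\<lambda>i. n x ^ Suc i)"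
    using nx n_nonneg[OF xA] by (subst summable_Suc_iff) (simp add: summable_geometric)
  then have "summable (\<lambda>i. n (pow1 x i))"
    by (rule summable_comparison_test'[where N = 0])
       (use n_pow1[OF xA] n_nonneg[OF A_closed(8)[OF xA]] in simp)
  then obtain y where y: "y \<in> S" "(\<lambda>m. n ((\<Sum>i<m. pow1 x i) - y)) \<longlonglongrightarrow> 0"
    using absolutely_convergent_series[of S "pow1 x", OF S subalgebra_pow1[OF S'(2) x]] by auto
  define X where "X m = (\<Sum>i<m. pow1 x i)" for m
  have yA: "y \<in> A" using S'(1) y(1) by blast
  have XA: "X m \<in> A" for m unfolding X_def by (intro A_closed xA)
  have X1: "X (Suc m) = x + x * X m" for m
    unfolding X_def by (subst sum.lessThan_Suc_shift) (simp add: sum_distrib_left)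
  have X2: "X (Suc m) = x + X m * x" for m
    unfolding X_def by (subst sum.lessThan_Suc_shift) (simp add: sum_distrib_right pow1_Suc_right del: pow1.simps(2))
  have Xy: "(\<lambda>m. n (X m - y)) \<longlonglongrightarrow> 0" using y by (simp add: X_def)
  \<comment> \<open>Limits for \<open>n\<close> are unique; left and right multiplication by
    \<open>x\<close> then yield the two equations.\<close>
  have limit: "y = z"
    if z: "z \<in> A" and le: "\<And>m. n (X (Suc m) - z) \<le> n x * n (X m - y)" for z
  proof -
    have "n (y - z) \<le> n (X (Suc m) - y) + n x * n (X m - y)" for m
      using n_diff_triangle[OF yA XA z, of "Suc m"] le[of m] n_diff_commute[OF yA XA, of "Suc m"] by simp
    moreover have "(\<lambda>m. n (X (Suc m) - y) + n x * n (X m - y)) \<longlonglongrightarrow> 0 + n x * 0"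
      using Xy by (intro tendsto_intros LIMSEQ_Suc)
    ultimately have "n (y - z) \<le> 0 + n x * 0"
      by (intro LIMSEQ_le_const) auto
    then show ?thesis
      using n_nonneg[of "y - z"] n_eq_0[of "y - z"] yA z by (auto simp: A_closed)
  qed
  have "y = x + x * y"
  proof (rule limit)
    have "X (Suc m) - (x + x * y) = x * (X m - y)" for m by (simp add: X1 right_diff_distrib)
    then show "n (X (Suc m) - (x + x * y)) \<le> n x * n (X m - y)" for m
      using n_mult[OF xA, of "X m - y"] XA yA by (simp add: A_closed)
  qed (intro A_closed xA yA)
  moreover have "y = x + y * x"
  proof (rule limit)
    have "X (Suc m) - (x + y * x) = (X m - y) * x" for m by (simp add: X2 left_diff_distrib)
    then show "n (X (Suc m) - (x + y * x)) \<le> n x * n (X m - y)" for m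
      using n_mult[OF _ xA, of "X m - y"] XA yA by (simp add: A_closed mult.commute)
  qed (intro A_closed xA yA)
  ultimately show ?thesis using y(1) by blast
qed

text \<open>Were \<open>n h\<close> smaller than \<open>norm h\<close>, a quasi-inverse would exist
  for every unimodular multiple of h / \<open>norm h\<close>, although one of them is a spectral
  obstruction in the C*-algebra.\<close>

lemma norm_le_n_self_adjoint:
  assumes h: "h \<in> A" "invol h = h"
  shows "norm h \<le> n h"
proof (rule ccontr)
  assume "\<not> ?thesis"
  then have less: "n h < norm h" by simp
  then have pos: "norm h > 0" using n_nonneg[OF h(1)] by linarith
  define g where "g = cscale (of_real (1 / norm h)) h"
  have "invol g = g" "norm g = 1"
    using h pos by (simp_all add: g_def invol_cscale norm_cscale norm_divide)
  then obtain l where l: "cmod l = 1" "\<not> is_invertible (1 - cscale l (Unitization g 0))"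
    using self_adjoint_not_invertible by blast
  define x where "x = cscale l g"
  have x: "x \<in> A" using h by (simp add: x_def g_def A_closed)
  have "n x < 1"
    using l less pos h by (simp add: x_def g_def n_cscale A_closed norm_divide)
  then obtain y where y: "y = x + x * y" "y = x + y * x"
    using quasi_inverse[OF closed_subalgebra_A x] by blast
  have "(1 - Unitization x 0) * (1 + Unitization y 0) = 1"
    "(1 + Unitization y 0) * (1 - Unitization x 0) = 1"
    using y by (simp_all add: unitization_defs cscale_one algebra_simps)
  then have "is_invertible (1 - Unitization x 0)"
    unfolding is_invertible_def by blast
  then show False
    using l(2) by (simp add: x_def cscale_unitization_def)
qed

lemma n_invol: "\<exists>M\<ge>0. \<forall>x\<in>A. n (invol x) \<le> M * n x"
proof -
  have "\<exists>M. \<forall>x\<in>A. n (invol x) \<le> M * n x"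
    using banach unfolding banach_star_subalgebra_def by (elim conjE)
  then obtain M where M: "\<And>x. x \<in> A \<Longrightarrow> n (invol x) \<le> M * n x" by blast
  have "n (invol x) \<le> max M 0 * n x" if "x \<in> A" for x
    using M[OF that] mult_right_mono[of M "max M 0" "n x"] n_nonneg[OF that] by linarith
  then show ?thesis by (intro exI[of _ "max M 0"]) auto
qed

text \<open>Apply the self-adjoint case to \<open>invol x * x\<close>; the bound M of the involution
  gives the constant sqrt M.\<close>

lemma norm_le_n: "\<exists>c. \<forall>x\<in>A. norm x \<le> c * n x"
proof -
  obtain M where M: "M \<ge> 0" "\<And>x. x \<in> A \<Longrightarrow> n (invol x) \<le> M * n x"
    using n_invol by blast
  have "norm x \<le> sqrt M * n x" if x: "x \<in> A" for x
  proof -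
    have "(norm x)\<^sup>2 \<le> n (invol x * x)"
      using norm_le_n_self_adjoint[of "invol x * x"] x
      by (simp add: cstar_identity A_closed invol_mult invol_invol)
    also have "\<dots> \<le> n (invol x) * n x" using x by (intro n_mult A_closed)
    also have "\<dots> \<le> M * n x * n x"
      using x by (intro mult_right_mono M n_nonneg)
    also have "\<dots> = (sqrt M * n x)\<^sup>2"
      using M by (simp add: power_mult_distrib power2_eq_square)
    finally show ?thesis
      using M n_nonneg[OF x] by (auto intro: power2_le_imp_le)
  qed
  then show ?thesis by blast
qed

lemma tendsto_of_n:
  assumes X: "\<And>i. X i \<in> A" and y: "y \<in> A" and lim: "(\<lambda>i. n (X i - y)) \<longlonglongrightarrow> 0"
  shows "X \<longlonglongrightarrow> y"
proof -
  obtain c where c: "\<And>x. x \<in> A \<Longrightarrow> norm x \<le> c * n x" using norm_le_n by blast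
  have "(\<lambda>i. c * n (X i - y)) \<longlonglongrightarrow> 0"
    using tendsto_mult[OF tendsto_const lim, of c] by simp
  then have "(\<lambda>i. X i - y) \<longlonglongrightarrow> 0"
    by (rule Lim_null_comparison[rotated]) (use c X y in \<open>auto intro!: always_eventually simp: A_closed\<close>)
  then show ?thesis by (simp add: LIM_zero_iff)
qed

lemma closed_subalgebra_commutant:
  assumes T: "T \<subseteq> A"
  shows "closed_subalgebra {x \<in> A. \<forall>y\<in>T. x * y = y * x}" (is "closed_subalgebra ?S")
  unfolding closed_subalgebra_def closed_in_norm_def
proof (intro conjI allI impI)
  show "subalgebra ?S"
    unfolding subalgebra_def using T
    by (auto simp: A_closed distrib_left distrib_right mult_cscale_left mult_cscale_right)
       (metis mult.assoc)
  fix X y assume "(\<forall>i. X i \<in> ?S) \<and> y \<in> A \<and> (\<lambda>i. n (X i - y)) \<longlonglongrightarrow> 0"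
  then have X: "X i \<in> ?S" and y: "y \<in> A" and lim: "(\<lambda>i. n (X i - y)) \<longlonglongrightarrow> 0" for i
    by auto
  have Xy: "X \<longlonglongrightarrow> y" using X y lim by (intro tendsto_of_n) auto
  have "y * t = t * y" if "t \<in> T" for t
  proof (rule LIMSEQ_unique)
    show "(\<lambda>i. X i * t) \<longlonglongrightarrow> y * t" by (intro tendsto_intros Xy)
    have "X i * t = t * X i" for i using X that by auto
    then show "(\<lambda>i. X i * t) \<longlonglongrightarrow> t * y"
      by (simp only:) (intro tendsto_intros Xy)
  qed
  then show "y \<in> ?S" using y by blast
qed auto

lemma closed_subalgebra_gen: "b \<in> A \<Longrightarrow> closed_subalgebra (gen_closed_subalg A n b)"
  and mem_gen_closed_subalg: "b \<in> gen_closed_subalg A n b"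
  and gen_closed_subalg_subset: "closed_subalgebra S \<Longrightarrow> b \<in> S \<Longrightarrow> gen_closed_subalg A n b \<subseteq> S"
proof -
  show "closed_subalgebra S \<Longrightarrow> b \<in> S \<Longrightarrow> gen_closed_subalg A n b \<subseteq> S" for S
    unfolding gen_closed_subalg_def closed_subalgebra_def by blast
  show "b \<in> gen_closed_subalg A n b"
    unfolding gen_closed_subalg_def by blast
  assume b: "b \<in> A"
  have "gen_closed_subalg A n b \<subseteq> A"
    using b closed_subalgebra_A unfolding gen_closed_subalg_def closed_subalgebra_def by blast
  moreover have "subalgebra (gen_closed_subalg A n b)"
    unfolding gen_closed_subalg_def subalgebra_def by auto
  moreover have "closed_in_norm A n (gen_closed_subalg A n b)"
    unfolding closed_in_norm_def
  proof (intro allI impI)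
    fix X y assume *: "(\<forall>i. X i \<in> gen_closed_subalg A n b) \<and> y \<in> A \<and> (\<lambda>i. n (X i - y)) \<longlonglongrightarrow> 0"
    show "y \<in> gen_closed_subalg A n b"
      unfolding gen_closed_subalg_def
    proof (rule InterI)
      fix S assume "S \<in> {S. S \<subseteq> A \<and> b \<in> S \<and> subalgebra S \<and> closed_in_norm A n S}"
      then have S: "closed_subalgebra S" "gen_closed_subalg A n b \<subseteq> S"
        by (auto simp: closed_subalgebra_def gen_closed_subalg_def)
      show "y \<in> S"
        by (rule closed_subalgebra_limit[OF S(1), of X]) (use * S(2) in auto)
    qed
  qed
  ultimately show "closed_subalgebra (gen_closed_subalg A n b)"
    by (simp add: closed_subalgebra_def)
qed

text \<open>Two commutants: everything in the algebra commutes with \<open>b\<close>, so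
  \<open>b\<close> lies in the commutant of the algebra, which then contains the whole
  algebra.\<close>

lemma gen_closed_subalg_commutative:
  assumes b: "b \<in> A" and "x \<in> gen_closed_subalg A n b" "y \<in> gen_closed_subalg A n b"
  shows "x * y = y * x"
proof -
  let ?D = "gen_closed_subalg A n b"
  have "?D \<subseteq> {x \<in> A. \<forall>y\<in>{b}. x * y = y * x}"
    using b by (intro gen_closed_subalg_subset closed_subalgebra_commutant) auto
  then have "?D \<subseteq> {x \<in> A. \<forall>y\<in>?D. x * y = y * x}"
    using b closed_subalgebraD(1)[OF closed_subalgebra_gen[OF b]]
    by (intro gen_closed_subalg_subset[OF closed_subalgebra_commutant]) auto
  then show ?thesis using assms by blast
qed

lemma gen_closed_subalg_invol:
  assumes b: "b \<in> A" "invol b = b" and x: "x \<in> gen_closed_subalg A n b"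
  shows "invol x \<in> gen_closed_subalg A n b"
proof -
  let ?D = "gen_closed_subalg A n b"
  note D = closed_subalgebraD[OF closed_subalgebra_gen[OF b(1)]]
  have "closed_subalgebra {x \<in> A. invol x \<in> ?D}"
    unfolding closed_subalgebra_def closed_in_norm_def
  proof (intro conjI allI impI)
    show "subalgebra {x \<in> A. invol x \<in> ?D}"
      unfolding subalgebra_def
      by (auto simp: A_closed subalgebra_closed[OF D(2)] invol_add invol_mult invol_cscale)
    fix X y assume "(\<forall>i. X i \<in> {x \<in> A. invol x \<in> ?D}) \<and> y \<in> A \<and> (\<lambda>i. n (X i - y)) \<longlonglongrightarrow> 0"
    then have X: "X i \<in> A" "invol (X i) \<in> ?D" and y: "y \<in> A" and lim: "(\<lambda>i. n (X i - y)) \<longlonglongrightarrow> 0" for i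
      by auto
    obtain M where M: "\<And>x. x \<in> A \<Longrightarrow> n (invol x) \<le> M * n x" using n_invol by blast
    have "invol (X i) - invol y = invol (X i - y)" for i
      using invol_add[of "X i - y" y] by simp
    then have le: "norm (n (invol (X i) - invol y)) \<le> M * n (X i - y)" for i
      using M[of "X i - y"] n_nonneg[of "invol (X i - y)"] X y by (simp add: A_closed)
    have "(\<lambda>i. M * n (X i - y)) \<longlonglongrightarrow> 0"
      using tendsto_mult[OF tendsto_const lim, of M] by simp
    then have "(\<lambda>i. n (invol (X i) - invol y)) \<longlonglongrightarrow> 0"
      by (rule Lim_null_comparison[OF always_eventually[OF allI[OF le]]])
    then have "invol y \<in> ?D"
      by (rule closed_subalgebra_limit[OF closed_subalgebra_gen[OF b(1)] X(2) A_invol[OF y]])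
    then show "y \<in> {x \<in> A. invol x \<in> ?D}" using y by simp
  qed auto
  then have "?D \<subseteq> {x \<in> A. invol x \<in> ?D}"
    using b mem_gen_closed_subalg by (intro gen_closed_subalg_subset) auto
  then show ?thesis using x by blast
qed

end

section \<open>Characters of closed subalgebras\<close>

lemma characterD:
  assumes "\<phi> \<in> characters D"
  shows "x \<in> D \<Longrightarrow> y \<in> D \<Longrightarrow> \<phi> (x + y) = \<phi> x + \<phi> y" "x \<in> D \<Longrightarrow> y \<in> D \<Longrightarrow> \<phi> (x * y) = \<phi> x * \<phi> y"
    "x \<in> D \<Longrightarrow> \<phi> (cscale c x) = c * \<phi> x" "x \<notin> D \<Longrightarrow> \<phi> x = 0" "\<exists>x\<in>D. \<phi> x \<noteq> 0"
  using assms unfolding characters_def by blast+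

lemma character_diff:
  assumes "\<phi> \<in> characters D" "subalgebra D" "x \<in> D" "y \<in> D"
  shows "\<phi> (x - y) = \<phi> x - \<phi> y"
  using characterD(1)[OF assms(1), of "x - y" y] assms by (simp add: subalgebra_closed)

lemma character_sum:
  assumes \<phi>: "\<phi> \<in> characters D" and D: "subalgebra D" and f: "\<And>i. i \<in> I \<Longrightarrow> f i \<in> D"
  shows "\<phi> (sum f I) = (\<Sum>i\<in>I. \<phi> (f i))"
  using f
proof (induction I rule: infinite_finite_induct)
  case (insert i I)
  then show ?case using characterD(1)[OF \<phi>, of "f i" "sum f I"] D by (simp add: subalgebra_closed)
qed (use characterD(3)[OF \<phi> subalgebra_zero[OF D], of 0] in auto)

context banach_star_sub
begin

text \<open>Otherwise some z with \<phi> z = 1 and \<open>n z < 1\<close> has a quasi-inverse y = z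
  + z y, and applying \<phi> gives \<phi> y = 1 + \<phi> y.\<close>

lemma character_le_n:
  assumes \<phi>: "\<phi> \<in> characters D" and D: "closed_subalgebra D" and x: "x \<in> D"
  shows "cmod (\<phi> x) \<le> n x"
proof (rule ccontr)
  assume "\<not> ?thesis"
  then have less: "n x < cmod (\<phi> x)" by simp
  have xA: "x \<in> A" using D x closed_subalgebraD by blast
  have nz: "\<phi> x \<noteq> 0" using less n_nonneg[OF xA] by auto
  define z where "z = cscale (1 / \<phi> x) x"
  have z: "z \<in> D" using D x by (simp add: z_def subalgebra_closed closed_subalgebraD)
  have "n z < 1" using less nz xA by (simp add: z_def n_cscale norm_divide)
  then obtain y where y: "y \<in> D" "y = z + z * y" using quasi_inverse[OF D z] by blast
  then have "\<phi> y = \<phi> z + \<phi> z * \<phi> y"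
    using characterD[OF \<phi>] D z by (metis closed_subalgebraD(2) subalgebra_mult)
  moreover have "\<phi> z = 1" using nz characterD(3)[OF \<phi> x] by (simp add: z_def)
  ultimately show False by simp
qed

lemma character_tendsto:
  assumes \<phi>: "\<phi> \<in> characters D" and D: "closed_subalgebra D"
    and X: "\<And>i. X i \<in> D" and y: "y \<in> D" and lim: "(\<lambda>i. n (X i - y)) \<longlonglongrightarrow> 0"
  shows "(\<lambda>i. \<phi> (X i)) \<longlonglongrightarrow> \<phi> y"
proof -
  have le: "cmod (\<phi> (X i) - \<phi> y) \<le> n (X i - y)" for i
    using character_le_n[OF \<phi> D, of "X i - y"] character_diff[OF \<phi> closed_subalgebraD(2)[OF D] X y] X y
    by (simp add: subalgebra_closed closed_subalgebraD(2)[OF D])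
  have "(\<lambda>i. \<phi> (X i) - \<phi> y) \<longlonglongrightarrow> 0"
    by (rule Lim_null_comparison[OF always_eventually[OF allI[OF le]] lim])
  then show ?thesis by (simp add: LIM_zero_iff)
qed

end

section \<open>Growth of powers of unitaries and regularity\<close>

text \<open>\<open>(1 + u) ^ m - 1\<close>, which needs no unit.\<close>
definition upow :: "'a::cstar_algebra \<Rightarrow> nat \<Rightarrow> 'a" where
  "upow u m = element (Unitization u 1 ^ m)"

lemma Unitization_power: "Unitization u 1 ^ m = Unitization (upow u m) 1"
  for u :: "'a::cstar_algebra"
proof -
  have "scalar (Unitization u 1 ^ m) = 1"
    by (induction m) (simp_all add: unitization_defs)
  then show ?thesis by (simp add: upow_def unitization.expand)
qed

lemma upow_0 [simp]: "upow u 0 = 0"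
  by (simp add: upow_def one_unitization_def)

lemma upow_1 [simp]: "upow u (Suc 0) = u"
  by (simp add: upow_def)

lemma upow_add: "upow u (m + l) = upow u m + upow u l + upow u m * upow u l"
  using power_add[of "Unitization u 1" m l] unfolding Unitization_power
  by (simp add: times_unitization_def cscale_one add_ac)

lemma upow_mem: "subalgebra S \<Longrightarrow> u \<in> S \<Longrightarrow> upow u m \<in> S"
proof (induction m)
  case (Suc m)
  then show ?case using upow_add[of u m 1] by (simp add: subalgebra_closed)
qed (simp add: subalgebra_closed)

lemma invol_upow: "invol (upow u m) = upow (invol u) m"
proof (induction m)
  case (Suc m)
  then show ?case
    using upow_add[of u m 1] upow_add[of "invol u" 1 m] by (simp add: invol_add invol_mult add_ac)
qed simp

lemma norm_upow_le_2:
  assumes u: "invol u * u + u + invol u = 0"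
  shows "norm (upow u m) \<le> 2"
proof -
  let ?w = "upow u m"
  have "Unitization (invol u) 1 * Unitization u 1 = 1"
    using u by (simp add: unitization_defs cscale_one)
  then have "Unitization (invol u) 1 ^ m * Unitization u 1 ^ m = 1"
    by (rule left_right_inverse_power)
  then have "invol ?w * ?w + (?w + invol ?w) = 0"
    unfolding Unitization_power invol_upow
    by (simp add: unitization_defs cscale_one add.assoc)
  then have "invol ?w * ?w = - (?w + invol ?w)"
    by (rule eq_neg_iff_add_eq_0[THEN iffD2])
  then have "(norm ?w)\<^sup>2 = norm (?w + invol ?w)"
    by (metis cstar_identity norm_minus_cancel)
  also have "\<dots> \<le> 2 * norm ?w"
    using norm_triangle_ineq[of ?w "invol ?w"] by simp
  finally have "norm ?w * norm ?w \<le> 2 * norm ?w" by (simp add: power2_eq_square)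
  then show ?thesis
    by (metis mult_le_cancel_right norm_ge_zero not_less order_less_le zero_le_numeral)
qed

lemma Unitization_pow1: "Unitization x 0 ^ Suc m = Unitization (pow1 x m) 0"
  for x :: "'a::cstar_algebra"
proof (induction m)
  case (Suc m)
  have "Unitization x 0 ^ Suc (Suc m) = Unitization x 0 * Unitization x 0 ^ Suc m"
    by (rule power_Suc)
  then show ?case unfolding Suc by (simp add: times_unitization_def)
qed simp

lemma sum_scaleR_Unitization:
  "(\<Sum>j\<in>I. e j *\<^sub>R Unitization (x j) 0) = Unitization (\<Sum>j\<in>I. cscale (of_real (e j)) (x j)) 0"
  for x :: "'i \<Rightarrow> 'a::cstar_algebra"
  by (induction I rule: infinite_finite_induct) (simp_all add: unitization_defs)

text \<open>The expansion of (V - 1)^k at V = (1 + u)^m, read off in the non-unital part; the index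
  \<open>k - 1\<close> of \<open>pow1\<close> stands for the power k.\<close>

lemma pow1_upow_expansion:
  assumes "k \<ge> 2"
  shows "\<exists>e :: nat \<Rightarrow> real. \<forall>(u::'a::cstar_algebra) m. pow1 (upow u m) (k - 1)
    = upow u (k * m) + (\<Sum>j=1..<k. cscale (of_real (e j)) (upow u (j * m)))"
proof -
  obtain e :: "nat \<Rightarrow> real" where e: "e k = 1"
    "\<And>V :: 'a unitization. (V - 1) ^ k = (\<Sum>j=1..k. e j *\<^sub>R (V ^ j - 1))"
    using power_minus_one_expansion[of k, where 'a = "'a unitization"] assms by auto
  have "pow1 (upow u m) (k - 1)
      = upow u (k * m) + (\<Sum>j=1..<k. cscale (of_real (e j)) (upow u (j * m)))" for u :: 'a and m
  proof -
    let ?V = "Unitization u 1 ^ m"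
    have "?V ^ j = Unitization u 1 ^ (j * m)" for j
      by (simp add: mult.commute flip: power_mult)
    then have "?V ^ j - 1 = Unitization (upow u (j * m)) 0" for j
      by (simp only: Unitization_power) (simp add: minus_unitization_def one_unitization_def)
    moreover have "(?V - 1) ^ k = Unitization (pow1 (upow u m) (k - 1)) 0"
      using Unitization_pow1[of "upow u m" "k - 1"] assms unfolding Unitization_power
      by (simp add: minus_unitization_def one_unitization_def)
    ultimately have "pow1 (upow u m) (k - 1) = (\<Sum>j=1..k. cscale (of_real (e j)) (upow u (j * m)))"
      using e(2)[of ?V] by (simp add: sum_scaleR_Unitization)
    also have "{1..k} = insert k {1..<k}" using assms by auto
    finally show ?thesis by (simp add: e(1) cscale_one)
  qed
  then show ?thesis by blast
qed

lemma character_upow: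
  assumes \<phi>: "\<phi> \<in> characters D" and D: "subalgebra D" and u: "u \<in> D"
  shows "\<phi> (upow u m) = (1 + \<phi> u) ^ m - 1"
proof (induction m)
  case 0
  show ?case using characterD(3)[OF \<phi> u, of 0] by simp
next
  case (Suc m)
  have "upow u (Suc m) = upow u m + u + upow u m * u"
    using upow_add[of u m 1] by simp
  then have "\<phi> (upow u (Suc m)) = \<phi> (upow u m) + \<phi> u + \<phi> (upow u m) * \<phi> u"
    using characterD(1,2)[OF \<phi>] upow_mem[OF D u, of m] u
    by (simp add: subalgebra_closed[OF D])
  then show ?case by (simp add: Suc algebra_simps)
qed

text \<open>Used for the moduli of 1 + \<phi> u and its inverse, to put the spectrum of the Cayley
  transform on the unit circle.\<close>

lemma le_1_of_subexponential:
  fixes a K \<gamma> :: real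
  assumes "0 < \<gamma>" "\<gamma> < 1" and le: "\<And>N. a ^ N \<le> 1 + exp (K * real N powr \<gamma>)"
  shows "a \<le> 1"
proof (rule ccontr)
  assume "\<not> ?thesis"
  then have a: "a > 1" by simp
  define l where "l = ln a"
  have l: "l > 0" "a ^ N = exp (l * real N)" for N
    using a by (simp_all add: l_def exp_of_nat2_mult)
  have "(\<lambda>N. exp (- l * real N)) \<longlonglongrightarrow> 0"
    using l(1) by real_asymp
  moreover have "(\<lambda>N. exp (K * real N powr \<gamma> - l * real N)) \<longlonglongrightarrow> 0"
    using l(1) assms(1,2) by real_asymp
  ultimately have "(\<lambda>N. exp (- l * real N) + exp (K * real N powr \<gamma> - l * real N)) \<longlonglongrightarrow> 0 + 0"
    by (rule tendsto_add)
  then have "(\<lambda>N. (1 + exp (K * real N powr \<gamma>)) / a ^ N) \<longlonglongrightarrow> 0"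
    by (simp add: l(2) exp_diff exp_minus add_divide_distrib inverse_eq_divide)
  then have "\<forall>\<^sub>F N in sequentially. (1 + exp (K * real N powr \<gamma>)) / a ^ N < 1"
    by (rule order_tendstoD) simp
  then obtain N where "(1 + exp (K * real N powr \<gamma>)) / a ^ N < 1"
    by (auto simp: eventually_sequentially)
  then show False using le[of N] a by (simp add: divide_less_eq)
qed

context banach_star_sub
begin

text \<open>The differential inequality is applied to \<open>(1 + u) ^ m - 1\<close>, whose \<open>C\<^sup>*\<close>-norm is at most 2:
  multiplying the exponent by \<open>k\<close> raises the norm only to the power \<open>p < k\<close>.\<close>
lemma upow_growth:
  fixes k :: nat and p q C :: real
  assumes k: "k \<ge> 2" and pq: "p > 0" "q > 0" "p + q = real k" and C: "C > 0"
    and diff: "\<And>a. a \<in> A \<Longrightarrow> n (pow1 a (k - 1)) \<le> C * n a powr p * norm a powr q"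
    and u: "u \<in> A" "invol u * u + u + invol u = 0"
  shows "\<exists>K \<gamma>. 0 < \<gamma> \<and> \<gamma> < 1 \<and> (\<forall>N. n (upow u N) \<le> exp (K * real N powr \<gamma>))"
proof -
  have uA: "upow u N \<in> A" for N by (rule upow_mem[OF A_subalgebra u(1)])
  obtain e :: "nat \<Rightarrow> real" where e: "\<And>(u::'b) m. pow1 (upow u m) (k - 1)
      = upow u (k * m) + (\<Sum>j=1..<k. cscale (of_real (e j)) (upow u (j * m)))"
    using pow1_upow_expansion[OF k] by blast
  define G where "G N = 1 + n (upow u N)" for N
  have G1: "G N \<ge> 1" for N using n_nonneg[OF uA] by (simp add: G_def)
  \<comment> \<open>\<open>p\<close> may be below 1, while the growth lemma wants an exponent
    between 1 and \<open>k\<close>.\<close>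
  define P where "P = max p 1"
  define E where "E = 1 + C * 2 powr q + (\<Sum>j=1..<k. \<bar>e j\<bar>)"
  have E1: "E \<ge> 1" using C by (simp add: E_def sum_nonneg)
  \<comment> \<open>\<open>T\<close> majorises every term on the right of the expansion.
    \<open>E\<close> collects their coefficients, with 2^q from the C*-norm bound and 1 from the
    shift in \<open>G\<close>.\<close>
  have key: "G (k * m) \<le> E * T" if T: "G m powr P \<le> T" "\<And>j. 1 \<le> j \<Longrightarrow> j < k \<Longrightarrow> G (j * m) \<le> T" for m T
  proof -
    have T1: "T \<ge> 1"
      using T(1) ge_one_powr_ge_zero[OF G1[of m], of P] by (simp add: P_def le_max_iff_disj)
    have "upow u (k * m) = pow1 (upow u m) (k - 1) - (\<Sum>j=1..<k. cscale (of_real (e j)) (upow u (j * m)))"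
      unfolding e by simp
    then have "n (upow u (k * m)) \<le> n (pow1 (upow u m) (k - 1))
        + n (\<Sum>j=1..<k. cscale (of_real (e j)) (upow u (j * m)))"
      using n_add[of "pow1 (upow u m) (k - 1)" "- (\<Sum>j=1..<k. cscale (of_real (e j)) (upow u (j * m)))"]
      by (simp add: A_closed uA n_minus)
    moreover have "n (pow1 (upow u m) (k - 1)) \<le> C * 2 powr q * T"
    proof -
      have "n (upow u m) powr p \<le> G m powr p"
        using n_nonneg[OF uA] pq by (intro powr_mono2) (auto simp: G_def)
      also have "\<dots> \<le> G m powr P" using G1 by (intro powr_mono) (auto simp: P_def)
      finally have np: "n (upow u m) powr p \<le> T" using T(1) by simp
      have "norm (upow u m) powr q \<le> 2 powr q"
        using norm_upow_le_2[OF u(2)] pq by (intro powr_mono2) auto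
      then have "C * n (upow u m) powr p * norm (upow u m) powr q \<le> C * T * 2 powr q"
        using np C T1 by (intro mult_mono) auto
      then show ?thesis using diff[OF uA, of m] by (simp add: mult_ac)
    qed
    moreover have "n (\<Sum>j=1..<k. cscale (of_real (e j)) (upow u (j * m))) \<le> (\<Sum>j=1..<k. \<bar>e j\<bar>) * T"
    proof -
      have "n (\<Sum>j=1..<k. cscale (of_real (e j)) (upow u (j * m)))
          \<le> (\<Sum>j=1..<k. n (cscale (of_real (e j)) (upow u (j * m))))"
        by (intro n_sum A_closed uA)
      also have "\<dots> \<le> (\<Sum>j=1..<k. \<bar>e j\<bar> * T)"
      proof (rule sum_mono)
        fix j assume j: "j \<in> {1..<k}"
        have "n (cscale (of_real (e j)) (upow u (j * m))) = \<bar>e j\<bar> * n (upow u (j * m))"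
          by (simp add: n_cscale uA)
        also have "\<dots> \<le> \<bar>e j\<bar> * T"
          using T(2)[of j] j by (intro mult_left_mono) (auto simp: G_def)
        finally show "n (cscale (of_real (e j)) (upow u (j * m))) \<le> \<bar>e j\<bar> * T" .
      qed
      finally show ?thesis by (simp add: sum_distrib_right)
    qed
    ultimately have "n (upow u (k * m)) \<le> C * 2 powr q * T + (\<Sum>j=1..<k. \<bar>e j\<bar>) * T"
      by linarith
    then show ?thesis using T1 by (simp add: G_def E_def algebra_simps)
  qed
  have "\<exists>K \<gamma>. 0 < \<gamma> \<and> \<gamma> < 1 \<and> (\<forall>N\<ge>1. ln (G N) \<le> K * real N powr \<gamma>)"
  proof (rule subadditive_growth[OF k, of P "ln E"])
    show "1 \<le> P" by (simp add: P_def)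
    show "P < real k" using pq k by (simp add: P_def)
    show "0 \<le> ln E" using E1 by simp
    show "0 \<le> ln (G N)" for N using G1 by simp
    show "ln (G (M + N)) \<le> ln (G M) + ln (G N)" for M N
    proof -
      have "n (upow u (M + N)) \<le> n (upow u M + upow u N) + n (upow u M * upow u N)"
        unfolding upow_add by (intro n_add A_closed uA)
      also have "\<dots> \<le> n (upow u M) + n (upow u N) + n (upow u M) * n (upow u N)"
        by (intro add_mono n_add n_mult uA)
      finally have "G (M + N) \<le> G M * G N" by (simp add: G_def algebra_simps)
      then have "ln (G (M + N)) \<le> ln (G M * G N)"
        using G1[of "M + N"] by (intro ln_mono) linarith+
      also have "\<dots> = ln (G M) + ln (G N)"
        using G1[of M] G1[of N] by (intro ln_mult_pos) linarith+
      finally show ?thesis .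
    qed
    fix m :: nat assume "m \<ge> 1"
    have lnle: "ln (G (k * m)) \<le> ln E + ln T" if "G (k * m) \<le> E * T" "T \<ge> 1" for T
    proof -
      have "ln (G (k * m)) \<le> ln (E * T)" using that G1[of "k * m"] by (intro ln_mono) linarith+
      also have "\<dots> = ln E + ln T" using E1 that by (intro ln_mult_pos) linarith+
      finally show ?thesis .
    qed
    \<comment> \<open>Take \<open>T\<close> to be the largest of the competing quantities; the case
      records whether that is \<open>G m powr P\<close> or some \<open>G (j * m)\<close>.\<close>
    show "ln (G (k * m)) \<le> ln E + P * ln (G m)
        \<or> (\<exists>j. 1 \<le> j \<and> j < k \<and> ln (G (k * m)) \<le> ln E + ln (G (j * m)))"
    proof (cases "\<forall>j. 1 \<le> j \<and> j < k \<longrightarrow> G (j * m) \<le> G m powr P")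
      case True
      then have "G (k * m) \<le> E * G m powr P" by (intro key) auto
      moreover have "1 \<le> G m powr P"
        using G1[of m] by (intro ge_one_powr_ge_zero) (auto simp: P_def)
      ultimately have "ln (G (k * m)) \<le> ln E + ln (G m powr P)" by (rule lnle)
      then show ?thesis using G1[of m] by (simp add: ln_powr)
    next
      case False
      have ne: "finite {1..<k}" "{1..<k} \<noteq> {}" using k by auto
      obtain j where j: "j \<in> {1..<k}" "\<And>i. i \<in> {1..<k} \<Longrightarrow> G (i * m) \<le> G (j * m)"
      proof -
        have "Max ((\<lambda>i. G (i * m)) ` {1..<k}) \<in> (\<lambda>i. G (i * m)) ` {1..<k}"
          using ne by (intro Max_in) auto
        then obtain j where "j \<in> {1..<k}" "Max ((\<lambda>i. G (i * m)) ` {1..<k}) = G (j * m)" by auto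
        with that[of j] ne show ?thesis by (metis Max_ge finite_imageI imageI)
      qed
      from False obtain i where "1 \<le> i" "i < k" "G m powr P < G (i * m)" by force
      then have "G m powr P \<le> G (j * m)" using j(2)[of i] by simp
      then have "G (k * m) \<le> E * G (j * m)" using j by (intro key) auto
      then have "ln (G (k * m)) \<le> ln E + ln (G (j * m))" by (rule lnle[OF _ G1])
      then show ?thesis using j by auto
    qed
  qed
  then obtain K \<gamma> where K: "0 < \<gamma>" "\<gamma> < 1" "\<And>N. N \<ge> 1 \<Longrightarrow> ln (G N) \<le> K * real N powr \<gamma>" by blast
  have "n (upow u N) \<le> exp (K * real N powr \<gamma>)" for N
  proof (cases "N = 0")
    case True
    then show ?thesis using n_eq_0[OF A_closed(1)] by simp
  next
    case False
    then have "G N \<le> exp (K * real N powr \<gamma>)"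
      using K(3)[of N] G1[of N] by (metis One_nat_def Suc_leI exp_le_cancel_iff exp_ln less_le_trans neq0_conv zero_less_one)
    then show ?thesis by (simp add: G_def)
  qed
  with K(1,2) show ?thesis by blast
qed

text \<open>With \<open>1 + u\<close> unitary, the series for a rapidly decaying \<open>c\<close> converges in \<open>D\<close>; its
  summands vanish at \<open>u = 0\<close>, hence the correction by the value at the angle \<open>s\<close>.\<close>
lemma trigonometric_calculus:
  fixes c :: "nat \<Rightarrow> real"
  assumes D: "closed_subalgebra D" and u: "u \<in> D" "invol u \<in> D"
    and growth: "0 < \<gamma>" "\<gamma> < g" "\<And>N. n (upow u N) \<le> exp (K * real N powr \<gamma>)"
    and decay: "\<kappa> > 0" "\<And>N. \<bar>c N\<bar> \<le> K' * exp (- \<kappa> * real N powr g)"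
  shows "\<exists>d\<in>D. \<forall>\<phi>\<in>characters D. \<forall>t. 1 + \<phi> u = cis t \<and> 1 + \<phi> (invol u) = cis (- t)
    \<longrightarrow> \<phi> d = complex_of_real ((\<Sum>N. c N * cos (real N * (t - s))) - (\<Sum>N. c N * cos (real N * s)))"
proof -
  note D' = closed_subalgebraD[OF D]
  note DA = subalgebra_closed[OF D'(2)]
  obtain M where M: "M \<ge> 0" "\<And>x. x \<in> A \<Longrightarrow> n (invol x) \<le> M * n x" using n_invol by blast
  let ?v = "invol u"
  have uD: "upow u N \<in> D" "upow ?v N \<in> D" for N
    using upow_mem[OF D'(2)] u by auto
  have uA: "upow u N \<in> A" "upow ?v N \<in> A" for N using uD D' by auto
  \<comment> \<open>The Fourier terms of index N and -N, translated by \<open>s\<close>. The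
    negative power comes from \<open>invol u\<close>, and continuity of the involution carries the
    growth bound over to it.\<close>
  define f where "f N = cscale (of_real (c N / 2) * cis (- (real N * s))) (upow u N)
    + cscale (of_real (c N / 2) * cis (real N * s)) (upow ?v N)" for N
  have fD: "f N \<in> D" for N unfolding f_def by (intro DA uD)
  have K'0: "K' \<ge> 0"
  proof -
    have "0 \<le> K' * exp (- \<kappa> * real 0 powr g)" using decay(2)[of 0] by linarith
    then show ?thesis by simp
  qed
  have nf: "n (f N) \<le> K' * (1 + M) * exp (K * real N powr \<gamma> - \<kappa> * real N powr g)" for N
  proof -
    have "n (f N) \<le> \<bar>c N\<bar> / 2 * n (upow u N) + \<bar>c N\<bar> / 2 * n (upow ?v N)"
      unfolding f_def by (rule order_trans[OF n_add]) (simp_all add: A_closed uA n_cscale norm_mult)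
    also have "n (upow ?v N) \<le> M * n (upow u N)"
      using M(2)[OF uA(1)[of N]] by (simp add: invol_upow)
    finally have "n (f N) \<le> \<bar>c N\<bar> / 2 * n (upow u N) + \<bar>c N\<bar> / 2 * (M * n (upow u N))"
      by (simp add: mult_left_mono)
    also have "\<dots> = \<bar>c N\<bar> * ((1 + M) / 2 * n (upow u N))" by (simp add: field_simps)
    also have "\<dots> \<le> (K' * exp (- \<kappa> * real N powr g)) * ((1 + M) * exp (K * real N powr \<gamma>))"
      using M K'0 n_nonneg[OF uA(1)] by (intro mult_mono decay growth) auto
    also have "\<dots> = K' * (1 + M) * exp (K * real N powr \<gamma> - \<kappa> * real N powr g)"
      by (simp add: exp_diff exp_minus field_simps)
    finally show ?thesis .
  qed
  have "summable (\<lambda>N. K' * (1 + M) * exp (K * real N powr \<gamma> - \<kappa> * real N powr g))"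
    by (intro summable_mult summable_exp_powr growth decay)
  then have "summable (\<lambda>N. n (f N))"
    by (rule summable_comparison_test'[where N = 0]) (use nf n_nonneg[OF D'(1)[OF fD]] in simp)
  then obtain d where d: "d \<in> D" "(\<lambda>m. n ((\<Sum>i<m. f i) - d)) \<longlonglongrightarrow> 0"
    using absolutely_convergent_series[of D f, OF D fD] by auto
  have sc: "summable (\<lambda>N. \<bar>c N\<bar>)"
  proof (rule summable_comparison_test'[where N = 0])
    show "summable (\<lambda>N. K' * exp (0 * real N powr \<gamma> - \<kappa> * real N powr g))"
      by (intro summable_mult summable_exp_powr growth decay)
  qed (use decay in simp)
  have "\<phi> d = complex_of_real ((\<Sum>N. c N * cos (real N * (t - s))) - (\<Sum>N. c N * cos (real N * s)))"
    if \<phi>: "\<phi> \<in> characters D" and t: "1 + \<phi> u = cis t" "1 + \<phi> ?v = cis (- t)" for \<phi> t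
  proof -
    have "(\<lambda>m. \<phi> (\<Sum>i<m. f i)) \<longlonglongrightarrow> \<phi> d"
      by (rule character_tendsto[OF \<phi> D _ d]) (intro DA fD)
    moreover have "\<phi> (\<Sum>i<m. f i) = (\<Sum>i<m. \<phi> (f i))" for m
      by (rule character_sum[OF \<phi> D'(2) fD])
    ultimately have s1: "(\<lambda>N. \<phi> (f N)) sums \<phi> d" by (simp add: sums_def)
    have "\<phi> (f N) = of_real (c N * cos (real N * (t - s)) - c N * cos (real N * s))" for N
    proof -
      have "\<phi> (f N) = of_real (c N / 2) * (cis (- (real N * s)) * (cis t ^ N - 1)
          + cis (real N * s) * (cis (- t) ^ N - 1))"
        unfolding f_def
        by (simp add: characterD(1,3)[OF \<phi>] DA uD character_upow[OF \<phi> D'(2)] u t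
            distrib_left mult.assoc)
      also have "cis (- (real N * s)) * (cis t ^ N - 1) + cis (real N * s) * (cis (- t) ^ N - 1)
          = of_real (2 * (cos (real N * (t - s)) - cos (real N * s)))"
        by (simp add: Complex.DeMoivre cis_mult right_diff_distrib complex_eq_iff algebra_simps
            cos_diff sin_diff sin_add cos_add)
      finally show ?thesis by (simp add: algebra_simps)
    qed
    then have "(\<lambda>N. \<phi> (f N)) sums of_real ((\<Sum>N. c N * cos (real N * (t - s))) - (\<Sum>N. c N * cos (real N * s)))"
      by (simp only: sums_of_real_iff) (intro sums_diff summable_sums summable_mult_cos sc)
    with s1 show ?thesis by (rule sums_unique2)
  qed
  with d(1) show ?thesis by blast
qed

text \<open>Since \<open>n\<close> dominates a multiple of the C*-norm, the algebra lies in the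
  C*-closure of the polynomials in \<open>b\<close> without constant term. A character of that
  closure separating \<open>d\<close> from 0 is then restricted.\<close>

lemma gen_closed_subalg_semisimple:
  assumes b: "b \<in> A" "invol b = b" and d: "d \<in> gen_closed_subalg A n b" "d \<noteq> 0"
  shows "\<exists>\<phi>\<in>characters (gen_closed_subalg A n b). \<phi> d \<noteq> 0"
proof -
  let ?D = "gen_closed_subalg A n b"
  note D = closed_subalgebraD[OF closed_subalgebra_gen[OF b(1)]]
  define P where "P = {pelt b p |p. poly p 0 = 0}"
  have ops: "x + y \<in> P" "x * y \<in> P" "cscale c x \<in> P" if "x \<in> P" "y \<in> P" for x y c
  proof -
    obtain p q where "x = pelt b p" "poly p 0 = 0" "y = pelt b q" "poly q 0 = 0"
      using \<open>x \<in> P\<close> \<open>y \<in> P\<close> by (auto simp: P_def)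
    then have "x + y = pelt b (p + q)" "x * y = pelt b (p * q)" "cscale c x = pelt b (smult c p)"
      "poly (p + q) 0 = 0" "poly (p * q) 0 = 0" "poly (smult c p) 0 = 0"
      by (simp_all add: pelt_simps)
    then show "x + y \<in> P" "x * y \<in> P" "cscale c x \<in> P" unfolding P_def by blast+
  qed
  have cl: "x + y \<in> closure P" "x * y \<in> closure P" "cscale c x \<in> closure P"
    if xy: "x \<in> closure P" "y \<in> closure P" for x y c
  proof -
    obtain f where f: "\<And>i. f i \<in> P" "f \<longlonglongrightarrow> x" using xy(1) unfolding closure_sequential by blast
    obtain g where g: "\<And>i. g i \<in> P" "g \<longlonglongrightarrow> y" using xy(2) unfolding closure_sequential by blast
    have "bounded_linear (cscale c :: 'b \<Rightarrow> 'b)"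
      by (rule bounded_linear_intro[where K = "cmod c"])
         (auto simp: cscale_add_right scaleR_cscale cscale_cscale mult_ac norm_cscale)
    then have "(\<lambda>i. cscale c (f i)) \<longlonglongrightarrow> cscale c x"
      using f(2) by (rule bounded_linear.tendsto)
    then show "cscale c x \<in> closure P"
      unfolding closure_sequential using ops(3)[OF f(1) f(1)] by (intro exI[of _ "\<lambda>i. cscale c (f i)"]) simp
    show "x + y \<in> closure P"
      unfolding closure_sequential using ops(1)[OF f(1) g(1)] tendsto_add[OF f(2) g(2)]
      by (intro exI[of _ "\<lambda>i. f i + g i"]) simp
    show "x * y \<in> closure P"
      unfolding closure_sequential using ops(2)[OF f(1) g(1)] tendsto_mult[OF f(2) g(2)]
      by (intro exI[of _ "\<lambda>i. f i * g i"]) simp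
  qed
  have "b \<in> P"
    unfolding P_def by (intro CollectI exI[of _ "[:0, 1:]"]) (simp add: pelt_def unitization_defs cscale_one)
  then have bP: "b \<in> closure P" using closure_subset[of P] by blast
  then have "0 \<in> closure P" using cl(3)[of b b 0] by simp
  then have sub: "subalgebra (A \<inter> closure P)"
    unfolding subalgebra_def using cl by (auto simp: A_closed)
  have "closed_in_norm A n (A \<inter> closure P)"
    unfolding closed_in_norm_def
  proof (intro allI impI)
    fix X y assume *: "(\<forall>i. X i \<in> A \<inter> closure P) \<and> y \<in> A \<and> (\<lambda>i. n (X i - y)) \<longlonglongrightarrow> 0"
    then have "X \<longlonglongrightarrow> y" by (intro tendsto_of_n) auto
    then have "y \<in> closure P"
      using * closed_sequentially[OF closed_closure[of P], of X y] by auto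
    then show "y \<in> A \<inter> closure P" using * by simp
  qed
  with sub bP b have DP: "?D \<subseteq> closure P"
    using gen_closed_subalg_subset[of "A \<inter> closure P" b] by (auto simp: closed_subalgebra_def)
  then have dP: "d \<in> closure P" using d(1) by blast
  obtain \<phi> :: "'b \<Rightarrow> complex" where
    \<phi>: "\<forall>x\<in>closure P. \<forall>y\<in>closure P. \<phi> (x + y) = \<phi> x + \<phi> y \<and> \<phi> (x * y) = \<phi> x * \<phi> y"
      "\<forall>c. \<forall>x\<in>closure P. \<phi> (cscale c x) = c * \<phi> x" "\<phi> d \<noteq> 0"
    using exists_separating_character[of b d, folded P_def, OF b(2) dP d(2)] by (elim exE conjE)
  have "(\<lambda>x. if x \<in> ?D then \<phi> x else 0) \<in> characters ?D"
    unfolding characters_def using \<phi> DP d by (auto simp: subalgebra_closed[OF D(2)] subset_iff)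
  then show ?thesis using \<phi>(3) d(1) by (intro bexI) auto
qed

text \<open>All characters are bounded by \<open>n\<close>, hence equicontinuous, so the elements
  where convergence holds form a closed subalgebra; it contains \<open>b\<close>.\<close>

lemma gen_closed_subalg_pointwise_limit:
  assumes b: "b \<in> A" and \<phi>: "\<And>m. \<phi> m \<in> characters (gen_closed_subalg A n b)"
    and \<omega>: "\<omega> \<in> characters (gen_closed_subalg A n b)" and lim: "(\<lambda>m. \<phi> m b) \<longlonglongrightarrow> \<omega> b"
  shows "(\<lambda>m. \<phi> m x) \<longlonglongrightarrow> \<omega> x"
proof (cases "x \<in> gen_closed_subalg A n b")
  case False
  then show ?thesis using characterD(4)[OF \<phi>] characterD(4)[OF \<omega>] by simp
next
  case True
  let ?D = "gen_closed_subalg A n b"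
  note D0 = closed_subalgebra_gen[OF b]
  note D = closed_subalgebraD[OF D0]
  have "closed_subalgebra {x \<in> ?D. (\<lambda>m. \<phi> m x) \<longlonglongrightarrow> \<omega> x}" (is "closed_subalgebra ?S")
    unfolding closed_subalgebra_def closed_in_norm_def
  proof (intro conjI allI impI)
    show "?S \<subseteq> A" using D by auto
    have zero: "\<psi> 0 = 0" if "\<psi> \<in> characters ?D" for \<psi>
      using characterD(3)[OF that subalgebra_zero[OF D(2)], of 0] by simp
    have "(\<lambda>m. \<phi> m 0) \<longlonglongrightarrow> \<omega> 0" by (simp add: zero[OF \<phi>] zero[OF \<omega>])
    then show "subalgebra ?S"
      unfolding subalgebra_def
      by (auto simp: subalgebra_closed[OF D(2)] characterD(1-3)[OF \<phi>] characterD(1-3)[OF \<omega>] \<phi> \<omega>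
          intro!: tendsto_intros)
    fix X y assume "(\<forall>i. X i \<in> ?S) \<and> y \<in> A \<and> (\<lambda>i. n (X i - y)) \<longlonglongrightarrow> 0"
    then have X: "X i \<in> ?D" "(\<lambda>m. \<phi> m (X i)) \<longlonglongrightarrow> \<omega> (X i)" and y: "y \<in> A"
      and Xy: "(\<lambda>i. n (X i - y)) \<longlonglongrightarrow> 0" for i by auto
    have yD: "y \<in> ?D" by (rule closed_subalgebra_limit[OF D0 X(1) y Xy])
    have close: "cmod (\<psi> (X i) - \<psi> y) \<le> n (X i - y)" if "\<psi> \<in> characters ?D" for \<psi> i
      using character_le_n[OF that D0, of "X i - y"] character_diff[OF that D(2) X(1) yD]
      by (simp add: subalgebra_closed[OF D(2)] X(1) yD)
    have "(\<lambda>m. \<phi> m y) \<longlonglongrightarrow> \<omega> y"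
    proof (rule tendstoI)
      fix e :: real assume "e > 0"
      then have "\<forall>\<^sub>F i in sequentially. n (X i - y) < e / 3"
        using order_tendstoD(2)[OF Xy, of "e / 3"] by simp
      then obtain i where i: "n (X i - y) < e / 3" by (auto simp: eventually_sequentially)
      have "\<forall>\<^sub>F m in sequentially. dist (\<phi> m (X i)) (\<omega> (X i)) < e / 3"
        using X(2)[of i] \<open>e > 0\<close> by (intro tendstoD) auto
      then show "\<forall>\<^sub>F m in sequentially. dist (\<phi> m y) (\<omega> y) < e"
      proof eventually_elim
        case (elim m)
        have "dist (\<phi> m y) (\<phi> m (X i)) < e / 3" "dist (\<omega> (X i)) (\<omega> y) < e / 3"
          using close[OF \<phi>, of m i] close[OF \<omega>, of i] i by (auto simp: dist_norm norm_minus_commute)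
        then show ?case
          using elim dist_triangle[of "\<phi> m y" "\<omega> y" "\<phi> m (X i)"]
            dist_triangle[of "\<phi> m (X i)" "\<omega> y" "\<omega> (X i)"] by linarith
      qed
    qed
    then show "y \<in> ?S" using yD by simp
  qed
  then have "?D \<subseteq> ?S"
    using lim mem_gen_closed_subalg by (intro gen_closed_subalg_subset) auto
  then show ?thesis using True by blast
qed

end

lemma closedin_characters_limit:
  fixes X :: "('a \<Rightarrow> complex) set"
  assumes X: "closedin (top_of_set S) X" and \<omega>: "\<omega> \<in> S"
    and \<phi>: "\<And>m::nat. \<phi> m \<in> X" and lim: "\<And>x. (\<lambda>m. \<phi> m x) \<longlonglongrightarrow> \<omega> x"
  shows "\<omega> \<in> X"
proof -
  obtain T where T: "closed T" "X = S \<inter> T"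
    using X by (auto simp: closedin_closed)
  have "limitin (product_topology (\<lambda>_. euclidean) UNIV) \<phi> \<omega> sequentially"
    using lim by (subst limitin_componentwise) auto
  then have "\<phi> \<longlonglongrightarrow> \<omega>"
    by (simp add: euclidean_product_topology)
  then have "\<omega> \<in> T"
    using \<phi> T by (intro Lim_in_closed_set[OF T(1), of \<phi> sequentially]) auto
  then show ?thesis using \<omega> T by simp
qed

context banach_star_sub
begin

text \<open>\<open>1 + u\<close> is the Cayley transform \<open>(1 + x) (1 - x)\<inverse>\<close> of a small imaginary multiple \<open>x\<close> of \<open>b\<close>,
  and \<open>u = 2 y\<close> with \<open>1 + y = (1 - x)\<inverse>\<close>.\<close>
lemma cayley_transform:
  assumes b: "b \<in> A" "invol b = b"
  shows "\<exists>u y x \<epsilon>. \<epsilon> > 0 \<and> x = cscale (\<i> * complex_of_real \<epsilon>) b \<and> y \<in> gen_closed_subalg A n b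
    \<and> u = cscale 2 y \<and> y = x + x * y \<and> invol u * u + u + invol u = 0"
proof -
  let ?D = "gen_closed_subalg A n b"
  note D0 = closed_subalgebra_gen[OF b(1)]
  \<comment> \<open>Small enough that \<open>n x < 1\<close>, so that the Neumann series for y
    converges.\<close>
  define \<epsilon> where "\<epsilon> = 1 / (n b + 1)"
  have \<epsilon>: "\<epsilon> > 0" using n_nonneg[OF b(1)] by (simp add: \<epsilon>_def)
  define x where "x = cscale (\<i> * complex_of_real \<epsilon>) b"
  have xD: "x \<in> ?D"
    unfolding x_def by (intro subalgebra_cscale closed_subalgebraD(2)[OF D0] mem_gen_closed_subalg)
  have "n x = \<epsilon> * n b"
    using b \<epsilon> by (simp add: x_def n_cscale norm_mult)
  also have "\<dots> < 1" using n_nonneg[OF b(1)] by (simp add: \<epsilon>_def)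
  finally obtain y where y: "y \<in> ?D" "y = x + x * y" "y = x + y * x"
    using quasi_inverse[OF D0 xD] by blast
  define z where "z = invol y"
  have "invol x = - x" using b by (simp add: x_def invol_cscale)
  then have "z = - x - z * x"
    using arg_cong[OF y(2), of invol] by (simp add: z_def invol_add invol_mult)
  then have zx: "z * x = - x - z" by (simp add: algebra_simps)
  have xy: "x * y = y - x" using y(2) by (simp add: algebra_simps)
  \<comment> \<open>Eliminating \<open>x\<close> leads to 2 z y + y + z = 0, which is the unitarity
    relation for u = 2 y.\<close>
  have "z * y = z * x + z * x * y"
    by (subst y(2)) (simp add: distrib_left mult.assoc)
  also have "\<dots> = - z - y - z * y"
    unfolding zx by (simp add: left_diff_distrib xy)
  finally have eq: "z * y = - z - y - z * y" .
  have "z * y + (z * y + y + z) = (- z - y - z * y) + (z * y + y + z)"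
    by (simp only: eq[symmetric])
  also have "\<dots> = 0" by simp
  finally have zy: "z * y + (z * y + y + z) = 0" .
  define u where "u = cscale 2 y"
  have "invol u * u + u + invol u = cscale 2 (cscale 2 (z * y) + y + z)"
    by (simp add: u_def z_def invol_cscale mult_cscale_left mult_cscale_right cscale_add_right)
  also have "cscale 2 (z * y) = z * y + z * y"
    using cscale_add_left[of 1 1 "z * y"] by (simp add: cscale_one)
  also have "z * y + z * y + y + z = 0" using zy by (simp add: add.assoc)
  finally show ?thesis using \<epsilon> y unfolding x_def u_def by (metis cscale_zero_right)
qed

text \<open>The map \<phi> \<mapsto> 1 + \<phi> u identifies the spectrum with a subset of the
  circle that omits 1, and a limit point along this coordinate is a limit in the spectrum. A bump on
  the circle then separates \<omega> from X.\<close>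

lemma regular_gen_closed_subalg:
  fixes k :: nat and p q C :: real
  assumes k: "k \<ge> 2" and pq: "p > 0" "q > 0" "p + q = real k" and C: "C > 0"
    and diff: "\<And>a. a \<in> A \<Longrightarrow> n (pow1 a (k - 1)) \<le> C * n a powr p * norm a powr q"
    and b: "b \<in> A" "invol b = b"
  shows "regular_alg (gen_closed_subalg A n b)"
proof -
  let ?D = "gen_closed_subalg A n b"
  note D0 = closed_subalgebra_gen[OF b(1)]
  note D = closed_subalgebraD[OF D0]
  note DC = subalgebra_closed[OF D(2)]
  obtain u y x \<epsilon> where \<epsilon>: "\<epsilon> > 0" and x: "x = cscale (\<i> * complex_of_real \<epsilon>) b" and y: "y \<in> ?D" "y = x + x * y"
    and u: "u = cscale 2 y" "invol u * u + u + invol u = 0"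
    using cayley_transform[OF b] by blast
  have uD: "u \<in> ?D" "invol u \<in> ?D"
    using y gen_closed_subalg_invol[OF b] by (auto simp: u DC)
  have xD: "x \<in> ?D" using mem_gen_closed_subalg by (simp add: x DC)
  obtain K \<gamma> where growth: "0 < \<gamma>" "\<gamma> < 1" "\<And>N. n (upow u N) \<le> exp (K * real N powr \<gamma>)"
    using upow_growth[OF k pq C diff D(1)[OF uD(1)] u(2)] by blast
  obtain M where M: "M \<ge> 0" "\<And>x. x \<in> A \<Longrightarrow> n (invol x) \<le> M * n x" using n_invol by blast
  have unit: "cmod (1 + \<phi> u) = 1" "1 + \<phi> (invol u) = inverse (1 + \<phi> u)" if \<phi>: "\<phi> \<in> characters ?D" for \<phi>
  proof -
    have "\<phi> (invol u * u + u + invol u) = 0"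
      using u(2) characterD(3)[OF \<phi> subalgebra_zero[OF D(2)], of 0] by simp
    then have "(1 + \<phi> (invol u)) * (1 + \<phi> u) = 1"
      using uD by (simp add: characterD(1,2)[OF \<phi>] DC algebra_simps)
    then show inv: "1 + \<phi> (invol u) = inverse (1 + \<phi> u)"
      by (metis inverse_unique mult.commute)
    have nz: "1 + \<phi> u \<noteq> 0" using \<open>_ * _ = 1\<close> by auto
    have pow: "cmod (1 + \<phi> v) ^ N \<le> 1 + n (upow v N)" if "v \<in> ?D" for v N
    proof -
      have "cmod ((1 + \<phi> v) ^ N - 1) \<le> n (upow v N)"
        using character_le_n[OF \<phi> D0 upow_mem[OF D(2) that]] character_upow[OF \<phi> D(2) that] by simp
      then show ?thesis
        using norm_triangle_ineq2[of "(1 + \<phi> v) ^ N" 1] by (simp add: norm_power)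
    qed
    have "cmod (1 + \<phi> u) \<le> 1"
      by (rule le_1_of_subexponential[OF growth(1,2), of _ K])
         (rule order_trans[OF pow[OF uD(1)]], simp add: growth(3))
    moreover have "cmod (1 + \<phi> (invol u)) \<le> 1"
    \<comment> \<open>\<open>ln (M + 1)\<close> absorbs the bound of the involution, and
      \<open>M + 1\<close> keeps it nonnegative. The case N = 0 is separate because
      \<open>0 powr \<gamma> = 0\<close> leaves no room for that factor.\<close>
    proof (rule le_1_of_subexponential[OF growth(1,2), of _ "K + ln (M + 1)"])
      fix N
      have "cmod (1 + \<phi> (invol u)) ^ N \<le> 1 + n (upow (invol u) N)" by (rule pow[OF uD(2)])
      also have "\<dots> \<le> 1 + exp ((K + ln (M + 1)) * real N powr \<gamma>)"
      proof (cases "N = 0")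
        case True
        then show ?thesis using n_eq_0[OF A_closed(1)] by simp
      next
        case False
        have "n (upow (invol u) N) \<le> M * n (upow u N)"
          using M(2)[OF D(1)[OF upow_mem[OF D(2) uD(1), of N]]] by (simp add: invol_upow)
        also have "\<dots> \<le> (M + 1) * exp (K * real N powr \<gamma>)"
          using M n_nonneg[OF D(1)[OF upow_mem[OF D(2) uD(1), of N]]]
          by (intro mult_mono growth) auto
        also have "\<dots> = exp (ln (M + 1) * 1 + K * real N powr \<gamma>)"
          using M by (simp add: exp_add)
        also have "\<dots> \<le> exp (ln (M + 1) * real N powr \<gamma> + K * real N powr \<gamma>)"
          using M False growth(1) unfolding exp_le_cancel_iff
          by (intro add_right_mono mult_left_mono ge_one_powr_ge_zero) auto
        finally show ?thesis by (simp add: algebra_simps)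
      qed
      finally show "cmod (1 + \<phi> (invol u)) ^ N \<le> 1 + exp ((K + ln (M + 1)) * real N powr \<gamma>)" .
    qed
    ultimately show "cmod (1 + \<phi> u) = 1"
      using nz unfolding inv norm_inverse by (simp add: inverse_le_1_iff)
  qed
  have angle: "\<exists>t. 1 + \<phi> u = cis t \<and> 1 + \<phi> (invol u) = cis (- t)" if \<phi>: "\<phi> \<in> characters ?D" for \<phi>
  proof (intro exI conjI)
    show t: "1 + \<phi> u = cis (Arg (1 + \<phi> u))"
      using unit(1)[OF \<phi>] rcis_cmod_Arg[of "1 + \<phi> u"] by (simp add: rcis_def)
    show "1 + \<phi> (invol u) = cis (- Arg (1 + \<phi> u))"
      unfolding unit(2)[OF \<phi>] using t by (metis cis_inverse)
  qed
  \<comment> \<open>Inverts the Cayley transform on characters: with \<phi> y = \<phi> u / 2, the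
    value at \<open>u\<close> determines the value at the generator \<open>b\<close>
    continuously.\<close>
  have \<phi>x: "1 + \<phi> y \<noteq> 0 \<and> \<phi> b = \<phi> y / (1 + \<phi> y) / (\<i> * of_real \<epsilon>)" if \<phi>: "\<phi> \<in> characters ?D" for \<phi>
  proof -
    have "\<phi> y = \<phi> (x + x * y)" using y(2) by simp
    then have "\<phi> x * (1 + \<phi> y) = \<phi> y"
      using xD y(1) by (simp add: characterD(1,2)[OF \<phi>] DC algebra_simps)
    moreover from this have "1 + \<phi> y \<noteq> 0" by force
    ultimately have "\<phi> x = \<phi> y / (1 + \<phi> y)" by (simp add: field_simps)
    moreover have "\<phi> x = \<i> * of_real \<epsilon> * \<phi> b"
      unfolding x by (rule characterD(3)[OF \<phi> mem_gen_closed_subalg])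
    then have "\<phi> b = \<phi> x / (\<i> * of_real \<epsilon>)" using \<epsilon> by simp
    ultimately have "\<phi> b = \<phi> y / (1 + \<phi> y) / (\<i> * of_real \<epsilon>)" by simp
    with \<open>1 + \<phi> y \<noteq> 0\<close> show ?thesis by simp
  qed
  have \<phi>y: "\<phi> y = \<phi> u / 2" if "\<phi> \<in> characters ?D" for \<phi>
    using characterD(3)[OF that y(1), of 2] by (simp add: u)
  have sep: "\<exists>d\<in>?D. (\<forall>\<phi>\<in>X. \<phi> d = 0) \<and> \<omega> d \<noteq> 0"
    if X: "closedin (top_of_set (characters ?D)) X" and \<omega>: "\<omega> \<in> characters ?D - X" for X \<omega>
  proof -
    have XC: "X \<subseteq> characters ?D" using closedin_imp_subset[OF X] .
    have \<omega>D: "\<omega> \<in> characters ?D" using \<omega> by simp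
    have cont: "(\<lambda>m. \<phi> m x) \<longlonglongrightarrow> \<omega> x"
      if \<phi>: "\<And>m::nat. \<phi> m \<in> characters ?D" and lim: "(\<lambda>m. \<phi> m u) \<longlonglongrightarrow> \<omega> u"
        and \<omega>: "\<omega> \<in> characters ?D" for \<phi> \<omega> x
    proof -
      have "(\<lambda>m. \<phi> m u / 2 / (1 + \<phi> m u / 2) / (\<i> * of_real \<epsilon>)) \<longlonglongrightarrow> \<omega> u / 2 / (1 + \<omega> u / 2) / (\<i> * of_real \<epsilon>)"
        using \<phi>x[OF \<omega>] \<phi>y[OF \<omega>] \<epsilon> by (intro tendsto_intros lim) auto
      then have "(\<lambda>m. \<phi> m b) \<longlonglongrightarrow> \<omega> b"
        using \<phi>x[OF \<omega>] \<phi>y[OF \<omega>] \<phi>x[OF \<phi>] \<phi>y[OF \<phi>] by simp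
      then show ?thesis
        by (rule gen_closed_subalg_pointwise_limit[OF b(1) \<phi> \<omega>])
    qed
    \<comment> \<open>Otherwise a sequence in X would converge to \<omega> at \<open>u\<close>,
      hence at \<open>b\<close>, hence pointwise, against closedness of X.\<close>
    have "\<exists>\<rho>>0. \<forall>\<phi>\<in>X. cmod (\<phi> u - \<omega> u) \<ge> \<rho>"
    proof (rule ccontr)
      assume "\<not> ?thesis"
      then have "\<exists>\<phi>\<in>X. cmod (\<phi> u - \<omega> u) < 1 / real (Suc m)" for m
        by (metis not_less of_nat_0_less_iff zero_less_Suc zero_less_divide_1_iff)
      then obtain \<phi> where \<phi>: "\<And>m. \<phi> m \<in> X" "\<And>m. cmod (\<phi> m u - \<omega> u) < 1 / real (Suc m)" by metis
      have "(\<lambda>m. \<phi> m u - \<omega> u) \<longlonglongrightarrow> 0"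
        by (rule Lim_null_comparison[OF always_eventually[OF allI[OF less_imp_le[OF \<phi>(2)]]]])
           (use LIMSEQ_inverse_real_of_nat in \<open>simp add: inverse_eq_divide\<close>)
      then have lim: "(\<lambda>m. \<phi> m u) \<longlonglongrightarrow> \<omega> u" by (simp add: LIM_zero_iff)
      have \<phi>C: "\<phi> m \<in> characters ?D" for m using \<phi>(1) XC by blast
      have "\<omega> \<in> X"
        by (rule closedin_characters_limit[OF X \<omega>D, of \<phi>])
           (rule \<phi>(1), rule cont[OF \<phi>C lim \<omega>D])
      then show False using \<omega> by simp
    qed
    then obtain \<rho> where \<rho>: "\<rho> > 0" "\<And>\<phi>. \<phi> \<in> X \<Longrightarrow> cmod (\<phi> u - \<omega> u) \<ge> \<rho>" by blast
    \<comment> \<open>The point 1 of the circle is excluded: there \<omega> would vanish at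
      \<open>b\<close>, and its kernel would be a closed subalgebra containing
      \<open>b\<close>.\<close>
    have "\<omega> u \<noteq> 0"
    proof
      assume "\<omega> u = 0"
      then have "\<omega> b = 0" using \<phi>x[OF \<omega>D] \<phi>y[OF \<omega>D] by simp
      have "closed_subalgebra {z \<in> ?D. \<omega> z = 0}" (is "closed_subalgebra ?S")
        unfolding closed_subalgebra_def closed_in_norm_def
      proof (intro conjI allI impI)
        show "?S \<subseteq> A" using D by auto
        show "subalgebra ?S"
          unfolding subalgebra_def using characterD(3)[OF \<omega>D subalgebra_zero[OF D(2)], of 0]
          by (auto simp: DC characterD(1-3)[OF \<omega>D])
        fix Z z assume "(\<forall>i. Z i \<in> ?S) \<and> z \<in> A \<and> (\<lambda>i. n (Z i - z)) \<longlonglongrightarrow> 0"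
        then have Z: "Z i \<in> ?D" "\<omega> (Z i) = 0" and z: "z \<in> A" "(\<lambda>i. n (Z i - z)) \<longlonglongrightarrow> 0" for i by auto
        have zD: "z \<in> ?D" by (rule closed_subalgebra_limit[OF D0 Z(1) z])
        have "(\<lambda>i. \<omega> (Z i)) \<longlonglongrightarrow> \<omega> z" by (rule character_tendsto[OF \<omega>D D0 Z(1) zD z(2)])
        then have "\<omega> z = 0" by (simp add: Z(2) LIMSEQ_const_iff)
        then show "z \<in> ?S" using zD by simp
      qed
      then have "?D \<subseteq> ?S"
        using \<open>\<omega> b = 0\<close> mem_gen_closed_subalg by (intro gen_closed_subalg_subset) auto
      then show False using characterD(5)[OF \<omega>D] by blast
    qed
    \<comment> \<open>The bump is centred up to \<open>r\<close> away from the angle of \<omega> and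
      reaches another \<open>r\<close>, so \<open>2 * r\<close> must stay below the distances to X
      and to 1.\<close>
    define r where "r = min \<rho> (cmod (\<omega> u)) / 3"
    have r: "r > 0" "2 * r < \<rho>" "2 * r < cmod (\<omega> u)"
      using \<rho>(1) \<open>\<omega> u \<noteq> 0\<close> by (auto simp: r_def min_def)
    define g where "g = (1 + \<gamma>) / 2"
    have g: "0 < g" "g < 1" "\<gamma> < g" using growth by (auto simp: g_def)
    obtain c K' \<kappa> where c: "\<kappa> > 0" "\<And>N. \<bar>c N\<bar> \<le> K' * exp (- \<kappa> * real N powr g)"
      "\<And>t. cmod (cis t - 1) > r \<Longrightarrow> (\<Sum>N. c N * cos (real N * t)) = 0"
      "\<exists>t. (\<Sum>N. c N * cos (real N * t)) \<noteq> 0"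
      using exists_rapidly_decaying_bump[OF g(1,2) r(1)] by blast
    obtain t1 where t1: "(\<Sum>N. c N * cos (real N * t1)) \<noteq> 0" using c(4) by blast
    then have ct1: "cmod (cis t1 - 1) \<le> r" using c(3)[of t1] by linarith
    obtain t0 where t0: "1 + \<omega> u = cis t0" "1 + \<omega> (invol u) = cis (- t0)" using angle[OF \<omega>D] by blast
    \<comment> \<open>Moves the angle of \<omega> to \<open>t1\<close>, where the bump does not
      vanish.\<close>
    define s where "s = t0 - t1"
    obtain d where d: "d \<in> ?D" "\<And>\<phi> t. \<phi> \<in> characters ?D \<Longrightarrow> 1 + \<phi> u = cis t \<Longrightarrow> 1 + \<phi> (invol u) = cis (- t)
        \<Longrightarrow> \<phi> d = complex_of_real ((\<Sum>N. c N * cos (real N * (t - s))) - (\<Sum>N. c N * cos (real N * s)))"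
      using trigonometric_calculus[OF D0 uD growth(1) g(3) growth(3) c(1,2), of s] by blast
    have "cis t0 = cis s * cis t1" by (simp add: s_def cis_mult)
    then have "cis t0 - cis s = cis s * (cis t1 - 1)" by (simp add: algebra_simps)
    then have t0s: "cmod (cis t0 - cis s) \<le> r" using ct1 by (simp add: norm_mult)
    have "cmod (\<omega> u) = cmod (cis t0 - 1)" using t0(1) by (simp add: algebra_simps flip: t0(1))
    then have "cmod (cis s - 1) > r"
      using t0s r(3) norm_triangle_ineq[of "cis t0 - cis s" "cis s - 1"] by simp
    \<comment> \<open>The correction at 1 is zero, so \<open>d\<close> takes exactly the values of
      the translated bump.\<close>
    then have Fs: "(\<Sum>N. c N * cos (real N * s)) = 0" by (rule c(3))
    have "t0 - s = t1" by (simp add: s_def)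
    then have "\<omega> d \<noteq> 0"
      using d(2)[OF \<omega>D t0] t1 by (simp add: Fs)
    moreover have "\<phi> d = 0" if "\<phi> \<in> X" for \<phi>
    proof -
      have \<phi>D: "\<phi> \<in> characters ?D" using that XC by blast
      obtain t where t: "1 + \<phi> u = cis t" "1 + \<phi> (invol u) = cis (- t)" using angle[OF \<phi>D] by blast
      have "\<phi> u - \<omega> u = cis t - cis t0" by (simp flip: t(1) t0(1))
      then have "\<rho> \<le> cmod (cis t - cis t0)" using \<rho>(2)[OF that] by simp
      then have "cmod (cis t - cis s) > r"
        using t0s r(2) norm_triangle_ineq[of "cis t - cis s" "cis s - cis t0"]
        by (simp add: norm_minus_commute)
      moreover have "cis t = cis s * cis (t - s)" by (simp add: cis_mult)
      then have "cis t - cis s = cis s * (cis (t - s) - 1)" by (simp add: algebra_simps)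
      ultimately have "cmod (cis (t - s) - 1) > r" by (simp add: norm_mult)
      then show ?thesis using d(2)[OF \<phi>D t] c(3)[of "t - s"] Fs by simp
    qed
    ultimately show ?thesis using d(1) by blast
  qed
  show ?thesis
    unfolding regular_alg_def
  proof (intro conjI ballI allI impI)
    show "x * y = y * x" if "x \<in> ?D" "y \<in> ?D" for x y
      by (rule gen_closed_subalg_commutative[OF b(1) that])
    show "d = 0" if "d \<in> ?D" "\<forall>\<phi>\<in>characters ?D. \<phi> d = 0" for d
      using gen_closed_subalg_semisimple[OF b that(1)] that(2) by blast
    show "\<exists>d\<in>?D. (\<forall>\<phi>\<in>X. \<phi> d = 0) \<and> \<omega> d \<noteq> 0"
      if "closedin (top_of_set (characters ?D)) X \<and> \<omega> \<in> characters ?D - X" for X \<omega>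
      by (rule sep[OF conjunct1[OF that] conjunct2[OF that]])
  qed
qed

end

theorem theorem3p12:
  fixes A :: "'b::cstar_algebra set" and nA :: "'b \<Rightarrow> real"
    and k :: nat and p q :: real
  assumes "differential_subalgebra k p q A nA"
  shows "locally_regular A nA"
proof -
  have bs: "banach_star_subalgebra A nA" and k: "k \<ge> 2" and pq: "p > 0" "q > 0" "p + q = real k"
    and ex: "\<exists>C>0. \<forall>a\<in>A. nA (pow1 a (k - 1)) \<le> C * nA a powr p * norm a powr q"
    using assms unfolding differential_subalgebra_def by blast+
  obtain C where C: "C > 0" "\<And>a. a \<in> A \<Longrightarrow> nA (pow1 a (k - 1)) \<le> C * nA a powr p * norm a powr q"
    using ex by blast
  interpret banach_star_sub A nA by standard (fact bs)
  have "reduced A"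
    unfolding reduced_def algebra_norm_on_def
    by (intro exI[of _ norm]) (auto simp: norm_triangle_ineq norm_mult_ineq norm_cscale cstar_identity)
  moreover have "regular_alg (gen_closed_subalg A nA b)" if "b \<in> A" "invol b = b" for b
    by (rule regular_gen_closed_subalg[OF k pq C that])
  \<comment> \<open>The dense set is the whole self-adjoint part, so each element approximates
    itself.\<close>
  moreover have "\<exists>r\<in>{a \<in> A. invol a = a}. nA (a - r) < e" if "a \<in> A" "invol a = a" "e > 0" for a e
    using that n_eq_0[OF A_closed(1)] by (intro bexI[of _ a]) auto
  ultimately show ?thesis
    unfolding locally_regular_def by (intro conjI exI[of _ "{a \<in> A. invol a = a}"]) auto
qed

end
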